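(* Let $\nu_k\to0^+$, $c_k\in J_{\nu_k}$, $c_k\to c=(c_1,c_2,c_3)\ne0$, $c_1c_2=0$ and $c_3>c_3^*(c_1,c_2)$. Then $$\lim_{k\to\infty}\|U^\pm_{\nu_k,\theta}(c_k)\mp\sqrt{2P_c}\|_{L^\infty(-1,1)}=0.$$ Moreover, for any $\epsilon>0$ and integer $m\ge0$ there exists a constant $C>0$, depending only on $\epsilon,m$ and $c$, such that for large $k$, $$\nu_k^{1/2}\left\|\tfrac12(U^\pm_{\nu_k,\theta}(c_k))^2-P_{c_k}\right\|_{L^\infty(-1,1)}+\|U^\pm_{\nu_k,\theta}(c_k)\mp\sqrt{2P_{c_k}}\|_{C^m(-1+\epsilon,1-\epsilon)}\le C\nu_k.$$
   Context: For $c=(c_1,c_2,c_3)\in\mathbb{R}^3$ let $P_c(x)=c_1(1-x)+c_2(1+x)+c_3(1-x^2)$. For $\nu\ge0$ let $$\bar c_3(c_1,c_2;\nu)=-\tfrac12\left(\sqrt{\nu^2+c_1}+\sqrt{\nu^2+c_2}\right)\left(\sqrt{\nu^2+c_1}+\sqrt{\nu^2+c_2}+2\nu\right),$$ $$J_\nu=\{c\in\mathbb{R}^3: c_1\ge-\nu^2,\ c_2\ge-\nu^2,\ c_3\ge\bar c_3(c_1,c_2;\nu)\}.$$ For $c_1,c_2\ge0$, $c_3^*(c_1,c_2)=\bar c_3(c_1,c_2;0)=-\frac12(c_1+2\sqrt{c_1c_2}+c_2)$. For $\nu>0$ and $c\in J_\nu$, consider the differential equation $$\nu(1-x^2)U'+2\nu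 xU+\tfrac12U^2=P_c(x),\qquad -1<x<1.$$ It is known that among its $C^1(-1,1)$ solutions there are a greatest one $U^+_{\nu,\theta}(c)$ (upper solution) and a least one $U^-_{\nu,\theta}(c)$ (lower solution), i.e. $U^-_{\nu,\theta}(c)\le U\le U^+_{\nu,\theta}(c)$ on $(-1,1)$ for every solution $U$; solutions extend continuously to $[-1,1]$. *)

theory Defs
  imports "HOL-Analysis.Analysis" "HOL-Probability.Essential_Supremum"
begin

definition P :: "real ^ 3 \<Rightarrow> real \<Rightarrow> real" where
  "P c x = c $ 1 * (1 - x) + c $ 2 * (1 + x) + c $ 3 * (1 - x\<^sup>2)"

definition c3_bar :: "real \<Rightarrow> real \<Rightarrow> real \<Rightarrow> real" where
  "c3_bar c1 c2 \<nu> =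
     - (1/2) * (sqrt (\<nu>\<^sup>2 + c1) + sqrt (\<nu>\<^sup>2 + c2)) *
       (sqrt (\<nu>\<^sup>2 + c1) + sqrt (\<nu>\<^sup>2 + c2) + 2 * \<nu>)"

definition J :: "real \<Rightarrow> (real ^ 3) set" where
  "J \<nu> = {c. c $ 1 \<ge> - \<nu>\<^sup>2 \<and> c $ 2 \<ge> - \<nu>\<^sup>2 \<and> c $ 3 \<ge> c3_bar (c $ 1) (c $ 2) \<nu>}"

(* Meant for c1, c2 >= 0, where it equals - (c1 + 2 * sqrt (c1 * c2) + c2) / 2. *)
definition c3_star :: "real \<Rightarrow> real \<Rightarrow> real" where
  "c3_star c1 c2 = c3_bar c1 c2 0"

(* Functions on (-1,1) are represented by total functions whose values
   elsewhere are irrelevant. *)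
definition is_solution :: "real \<Rightarrow> real ^ 3 \<Rightarrow> (real \<Rightarrow> real) \<Rightarrow> bool" where
  "is_solution \<nu> c U \<longleftrightarrow>
     U C1_differentiable_on {-1<..<1} \<and>
     (\<forall>x\<in>{-1<..<1}. \<nu> * (1 - x\<^sup>2) * deriv U x + 2 * \<nu> * x * U x + (1/2) * (U x)\<^sup>2 = P c x)"

(* These determine U uniquely on (-1,1), and only there. *)
definition is_upper_solution :: "real \<Rightarrow> real ^ 3 \<Rightarrow> (real \<Rightarrow> real) \<Rightarrow> bool" where
  "is_upper_solution \<nu> c U \<longleftrightarrow>
     is_solution \<nu> c U \<and> (\<forall>V. is_solution \<nu> c V \<longrightarrow> (\<forall>x\<in>{-1<..<1}. V x \<le> U x))"

definition is_lower_solution :: "real \<Rightarrow> real ^ 3 \<Rightarrow> (real \<Rightarrow> real) \<Rightarrow> bool" where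
  "is_lower_solution \<nu> c U \<longleftrightarrow>
     is_solution \<nu> c U \<and> (\<forall>V. is_solution \<nu> c V \<longrightarrow> (\<forall>x\<in>{-1<..<1}. U x \<le> V x))"

(* Norms take values in [0,\<infinity>], so that a finite bound on a norm also asserts
   membership in the space. *)
definition Linf_norm :: "real set \<Rightarrow> (real \<Rightarrow> real) \<Rightarrow> ennreal" where
  "Linf_norm S f = esssup (lebesgue_on S) (\<lambda>x. ennreal \<bar>f x\<bar>)"

(* Meant for open S, where deriv ^^ i depends only on the values in S. *)
definition C_differentiable_on :: "nat \<Rightarrow> real set \<Rightarrow> (real \<Rightarrow> real) \<Rightarrow> bool" where
  "C_differentiable_on m S f \<longleftrightarrow>
     (\<forall>i<m. \<forall>x\<in>S. (deriv ^^ i) f differentiable (at x)) \<and> continuous_on S ((deriv ^^ m) f)"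

definition C_norm :: "nat \<Rightarrow> real set \<Rightarrow> (real \<Rightarrow> real) \<Rightarrow> ennreal" where
  "C_norm m S f =
     (if C_differentiable_on m S f
      then \<Sum>i\<le>m. SUP x\<in>S. ennreal \<bar>(deriv ^^ i) f x\<bar> else \<infinity>)"

definition vanishing_viscosity_seq :: "(nat \<Rightarrow> real) \<Rightarrow> (nat \<Rightarrow> real ^ 3) \<Rightarrow> real ^ 3 \<Rightarrow> bool" where
  "vanishing_viscosity_seq \<nu> cs c \<longleftrightarrow>
     (\<forall>k. \<nu> k > 0) \<and> \<nu> \<longlonglongrightarrow> 0 \<and> (\<forall>k. cs k \<in> J (\<nu> k)) \<and> cs \<longlonglongrightarrow> c"

end

theory Submission
  imports Defs
begin

text \<open>
  The substitution \<open>Y = U + 2 \<nu> x\<close> removes the linear term: \<open>U\<close> is a solution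
  iff \<open>\<nu> (1 - x\<^sup>2) Y' + Y\<^sup>2 / 2 = p\<close> with \<open>p = P c + 2 \<nu>\<^sup>2\<close> (\<open>is_solution_iff_riccati\<close>). If \<open>c\<close> lies in
  \<open>J \<nu>\<close> and is close to a limit as in the theorem, then \<open>p \<ge> \<kappa> (1 - x\<^sup>2)\<close> on \<open>(-1,1)\<close>, where \<open>\<kappa> > 0\<close>
  depends only on the limit (\<open>P_lower_bound\<close>, \<open>eventually_admissible\<close>).

  Global estimates come from barriers. The greatest solution lies above every subsolution, since a
  subsolution exceeding it somewhere would allow the explicit construction of a larger solution
  (\<open>subsolution_le_maximal\<close>); every solution lies below every nonnegative supersolution, since otherwise
  it would blow up on its way to \<open>-1\<close> (\<open>solution_le_supersolution\<close>). With \<open>a\<close> a suitable multiple of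
  \<open>\<nu>\<close>, the functions \<open>sqrt (2 p + a\<^sup>2) - a\<close> and \<open>sqrt (2 p + a\<^sup>2) + a\<close> are such barriers
  (\<open>maximal_solution_near_sqrt\<close>). Hence \<open>Y\<^sup>2 = 2 P c + O(\<nu>)\<close> uniformly on \<open>(-1,1)\<close>, which gives the uniform
  convergence and the bound on \<open>U\<^sup>2 / 2 - P c\<close>, even with the rate \<open>\<nu>\<close> in place of \<open>sqrt \<nu>\<close>.

  In the interior \<open>U\<close> is bounded below by a positive constant. Differentiating the equation once gives
  \<open>\<nu> (1 - x\<^sup>2) U'' + U U' = (P c)' - 2 \<nu> U\<close>, a linear equation for \<open>U'\<close> with strong damping. Such an
  equation transports a bound from one point to everything on its right without loss in \<open>\<nu>\<close>, and the
  mean value theorem provides a point where \<open>U'\<close> is bounded (\<open>damped_bound\<close>). Induction on the order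
  bounds all derivatives of \<open>U\<close> on compact subintervals, uniformly in \<open>\<nu>\<close> (\<open>damped_bdd_derivs\<close>,
  \<open>interior_bdd_derivs\<close>). Finally
  \<open>U - sqrt (2 P c) = -2 \<nu> ((1 - x\<^sup>2) U' + 2 x U) / (U + sqrt (2 P c))\<close>, and the fraction without its factor
  \<open>\<nu>\<close> has bounded derivatives.

  Lower solutions are reflected upper solutions (\<open>lower_reflect_is_upper\<close>). Since the constants must
  not depend on the sequences, all of this is done for the class of all triples \<open>(\<nu>, c, U)\<close> that satisfy
  the lower bound with a given \<open>\<kappa>\<close> (\<open>admissible\<close>).
\<close>

section \<open>The Riccati equation and its barriers\<close>

text \<open>
  \<open>\<nu> (1 - x\<^sup>2) Y' + Y\<^sup>2 / 2 = p\<close> on \<open>(-1,1)\<close>, solved for \<open>Y'\<close> so that the \<open>C\<^sup>1\<close> regularity of a solution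
  is automatic.
\<close>

definition riccati :: "real \<Rightarrow> (real \<Rightarrow> real) \<Rightarrow> (real \<Rightarrow> real) \<Rightarrow> bool" where
  "riccati \<nu> p Y \<longleftrightarrow>
     (\<forall>x\<in>{-1<..<1}. (Y has_real_derivative (p x - (Y x)\<^sup>2 / 2) / (\<nu> * (1 - x\<^sup>2))) (at x))"

definition maximal_riccati :: "real \<Rightarrow> (real \<Rightarrow> real) \<Rightarrow> (real \<Rightarrow> real) \<Rightarrow> bool" where
  "maximal_riccati \<nu> p Y \<longleftrightarrow>
     riccati \<nu> p Y \<and> (\<forall>V. riccati \<nu> p V \<longrightarrow> (\<forall>x\<in>{-1<..<1}. V x \<le> Y x))"

lemma one_minus_sq_pos:
  fixes x :: real
  assumes "x \<in> {-1<..<1}"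
  shows "0 < 1 - x\<^sup>2"
proof -
  have "0 < (1 - x) * (1 + x)"
    using assms by (intro mult_pos_pos) auto
  thus ?thesis by (simp add: power2_eq_square algebra_simps)
qed

text \<open>
  Subtracting \<open>-2 \<nu> x\<close>, the solution that corresponds to \<open>p = 0\<close> and \<open>Y = 0\<close>, absorbs the term
  \<open>2 \<nu> x U\<close> at the price of the constant \<open>2 \<nu>\<^sup>2\<close> on the right. For \<open>c \<in> J \<nu>\<close> this constant is just what
  makes the right-hand side nonnegative at both endpoints.
\<close>

lemma is_solution_iff_riccati:
  assumes "\<nu> > 0"
  shows "is_solution \<nu> c U \<longleftrightarrow>
         riccati \<nu> (\<lambda>x. P c x + 2 * \<nu>\<^sup>2) (\<lambda>x. U x + 2 * \<nu> * x)"
proof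
  assume U: "is_solution \<nu> c U"
  show "riccati \<nu> (\<lambda>x. P c x + 2 * \<nu>\<^sup>2) (\<lambda>x. U x + 2 * \<nu> * x)"
    unfolding riccati_def
  proof
    fix x :: real assume x: "x \<in> {-1<..<1}"
    have eq: "\<nu> * (1 - x\<^sup>2) * deriv U x + 2 * \<nu> * x * U x + (1/2) * (U x)\<^sup>2 = P c x"
      using U x by (auto simp: is_solution_def)
    have "U differentiable (at x)"
      using U x by (auto simp: is_solution_def C1_differentiable_on_eq)
    hence "(U has_real_derivative deriv U x) (at x)"
      by (simp add: DERIV_deriv_iff_real_differentiable)
    hence "((\<lambda>x. U x + 2 * \<nu> * x) has_real_derivative deriv U x + 2 * \<nu>) (at x)"
      by (auto intro!: derivative_eq_intros)
    also have "deriv U x + 2 * \<nu> =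
        (P c x + 2 * \<nu>\<^sup>2 - (U x + 2 * \<nu> * x)\<^sup>2 / 2) / (\<nu> * (1 - x\<^sup>2))"
      using one_minus_sq_pos[OF x] assms unfolding eq[symmetric]
      by (simp add: field_simps) (simp add: power2_eq_square algebra_simps)
    finally show "((\<lambda>x. U x + 2 * \<nu> * x) has_real_derivative
        (P c x + 2 * \<nu>\<^sup>2 - (U x + 2 * \<nu> * x)\<^sup>2 / 2) / (\<nu> * (1 - x\<^sup>2))) (at x)" .
  qed
next
  assume R: "riccati \<nu> (\<lambda>x. P c x + 2 * \<nu>\<^sup>2) (\<lambda>x. U x + 2 * \<nu> * x)"
  define D where
    "D = (\<lambda>x. (P c x + 2 * \<nu>\<^sup>2 - (U x + 2 * \<nu> * x)\<^sup>2 / 2) / (\<nu> * (1 - x\<^sup>2)) - 2 * \<nu>)"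
  have D: "(U has_real_derivative D x) (at x)" if x: "x \<in> {-1<..<1}" for x
  proof -
    have "((\<lambda>x. (U x + 2 * \<nu> * x) - 2 * \<nu> * x) has_real_derivative D x) (at x)"
      unfolding D_def using R x
      by (intro DERIV_diff) (auto simp: riccati_def intro!: derivative_eq_intros)
    thus ?thesis by simp
  qed
  have "continuous_on {-1<..<1} U"
    using D DERIV_continuous continuous_at_imp_continuous_on by blast
  hence "continuous_on {-1<..<1} D"
    unfolding D_def P_def using one_minus_sq_pos assms
    by (intro continuous_intros) (force)+
  hence "U C1_differentiable_on {-1<..<1}"
    using D unfolding C1_differentiable_on_def has_real_derivative_iff_has_vector_derivative
    by blast
  moreover have "\<nu> * (1 - x\<^sup>2) * deriv U x + 2 * \<nu> * x * U x + (1/2) * (U x)\<^sup>2 = P c x"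
    if x: "x \<in> {-1<..<1}" for x
  proof -
    have "deriv U x = D x" using D[OF x] by (rule DERIV_imp_deriv)
    hence "\<nu> * (1 - x\<^sup>2) * deriv U x =
        P c x + 2 * \<nu>\<^sup>2 - (U x + 2 * \<nu> * x)\<^sup>2 / 2 - 2 * \<nu>\<^sup>2 * (1 - x\<^sup>2)"
      using one_minus_sq_pos[OF x] assms unfolding D_def
      by (simp add: field_simps power2_eq_square)
    thus ?thesis by (simp add: power2_eq_square field_simps)
  qed
  ultimately show "is_solution \<nu> c U" by (simp add: is_solution_def)
qed

lemma antiderivative_on_interval:
  fixes f :: "real \<Rightarrow> real"
  assumes "\<And>x. x \<in> {-1<..<1} \<Longrightarrow> isCont f x"
  obtains F where "\<And>x. x \<in> {-1<..<1} \<Longrightarrow> (F has_real_derivative f x) (at x)"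
proof -
  have "\<exists>F. \<forall>x. ereal (-1) < ereal x \<longrightarrow> ereal x < ereal 1 \<longrightarrow> (F has_vector_derivative f x) (at x)"
    using assms by (intro einterval_antiderivative) auto
  thus ?thesis using that by (auto simp: has_real_derivative_iff_has_vector_derivative)
qed

lemma nonincreasing_on_interval:
  fixes f :: "real \<Rightarrow> real"
  assumes "x \<le> y" and "x \<in> {-1<..<1}" "y \<in> {-1<..<1}"
    and "\<And>t. t \<in> {-1<..<1} \<Longrightarrow> x \<le> t \<Longrightarrow> t \<le> y \<Longrightarrow> \<exists>d\<le>0. (f has_real_derivative d) (at t)"
  shows "f y \<le> f x"
  using assms(1)
proof (rule DERIV_nonpos_imp_nonincreasing)
  fix t assume "x \<le> t" "t \<le> y"
  thus "\<exists>d. (f has_real_derivative d) (at t) \<and> d \<le> 0"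
    using assms(2,3) assms(4)[of t] by force
qed

text \<open>
  A Riccati equation with one known solution \<open>y\<close> is solved by quadratures: if \<open>e' = - y e / (\<nu> s)\<close> and
  \<open>D' = e / s\<close>, then \<open>y + 2 \<nu> e / D\<close> is a solution wherever \<open>D\<close> does not vanish. The left-hand side
  below is the derivative of this expression.
\<close>

lemma riccati_shift_identity:
  fixes \<nu> s e D y p :: real
  assumes "\<nu> > 0" "s > 0" "D > 0"
  shows "(p - y\<^sup>2 / 2) / (\<nu> * s)
       + (2 * \<nu> * (e * (- (y / (\<nu> * s)))) * D - 2 * \<nu> * e * (e / s)) / D\<^sup>2
       = (p - (y + 2 * \<nu> * e / D)\<^sup>2 / 2) / (\<nu> * s)"
proof -
  define r where "r = e / D"
  have e: "e = r * D" using assms by (simp add: r_def)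
  have "(2 * \<nu> * (e * (- (y / (\<nu> * s)))) * D - 2 * \<nu> * e * (e / s)) / D\<^sup>2
     = - (2 * \<nu> * r * y + 2 * \<nu>\<^sup>2 * r\<^sup>2) / (\<nu> * s)"
    unfolding e using assms
    by (simp add: divide_simps power2_eq_square) (simp add: algebra_simps)
  moreover have "y + 2 * \<nu> * e / D = y + 2 * \<nu> * r" by (simp add: r_def)
  ultimately show ?thesis
    by (simp add: add_divide_distrib[symmetric] diff_divide_distrib[symmetric])
       (simp add: power2_eq_square algebra_simps)
qed

text \<open>
  Suppose \<open>w > Y\<close> at \<open>x0\<close>. Put \<open>E = exp (-L)\<close> with \<open>L' = Y / (\<nu> (1 - x\<^sup>2))\<close>, let \<open>I' = E / (1 - x\<^sup>2)\<close>,
  and let \<open>\<zeta> = (w - Y) / E\<close>. The Riccati inequality for \<open>w\<close> becomes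
  \<open>\<zeta>' \<le> - \<zeta>\<^sup>2 E / (2 \<nu> (1 - x\<^sup>2))\<close>. Hence \<open>\<zeta>\<close> stays positive to the left of \<open>x0\<close>, and there
  \<open>I - 2 \<nu> / \<zeta>\<close> is nonincreasing, which bounds \<open>I\<close> from below. So some \<open>K + I\<close> is positive on all of
  \<open>(-1,1)\<close>, and \<open>Y + 2 \<nu> E / (K + I)\<close> is a solution larger than \<open>Y\<close>.
\<close>

lemma subsolution_le_maximal:
  assumes "\<nu> > 0" and max: "maximal_riccati \<nu> p Y"
    and w: "\<And>x. x \<in> {-1<..<1} \<Longrightarrow> (w has_real_derivative w' x) (at x)"
    and sub: "\<And>x. x \<in> {-1<..<1} \<Longrightarrow> \<nu> * (1 - x\<^sup>2) * w' x + (w x)\<^sup>2 / 2 \<le> p x"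
    and x0: "x0 \<in> {-1<..<1}"
  shows "w x0 \<le> Y x0"
proof (rule ccontr)
  assume "\<not> ?thesis"
  hence gt: "w x0 - Y x0 > 0" by simp
  have Y: "riccati \<nu> p Y" and maximal: "\<And>V x. riccati \<nu> p V \<Longrightarrow> x \<in> {-1<..<1} \<Longrightarrow> V x \<le> Y x"
    using max by (auto simp: maximal_riccati_def)
  have Yd: "(Y has_real_derivative (p x - (Y x)\<^sup>2 / 2) / (\<nu> * (1 - x\<^sup>2))) (at x)"
    if "x \<in> {-1<..<1}" for x
    using Y that by (auto simp: riccati_def)
  obtain L where L: "\<And>x. x \<in> {-1<..<1} \<Longrightarrow> (L has_real_derivative Y x / (\<nu> * (1 - x\<^sup>2))) (at x)"
  proof (rule antiderivative_on_interval)
    fix x :: real assume x: "x \<in> {-1<..<1}"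
    show "isCont (\<lambda>x. Y x / (\<nu> * (1 - x\<^sup>2))) x"
      using one_minus_sq_pos[OF x] assms(1) DERIV_isCont[OF Yd[OF x]]
      by (intro continuous_intros) auto
  qed (use that in blast)
  obtain I where I: "\<And>x. x \<in> {-1<..<1} \<Longrightarrow> (I has_real_derivative exp (- L x) / (1 - x\<^sup>2)) (at x)"
  proof (rule antiderivative_on_interval)
    fix x :: real assume x: "x \<in> {-1<..<1}"
    show "isCont (\<lambda>x. exp (- L x) / (1 - x\<^sup>2)) x"
      using one_minus_sq_pos[OF x] DERIV_isCont[OF L[OF x]]
      by (intro continuous_intros) auto
  qed (use that in blast)
  define \<zeta> where "\<zeta> = (\<lambda>x. (w x - Y x) * exp (L x))"
  define \<zeta>' where "\<zeta>' = (\<lambda>x. ((w' x - (p x - (Y x)\<^sup>2 / 2) / (\<nu> * (1 - x\<^sup>2)))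
      + (w x - Y x) * (Y x / (\<nu> * (1 - x\<^sup>2)))) * exp (L x))"
  have \<zeta>: "(\<zeta> has_real_derivative \<zeta>' x) (at x)" if "x \<in> {-1<..<1}" for x
  proof -
    note DERIV_mult[OF DERIV_diff[OF w[OF that] Yd[OF that]] DERIV_fun_exp[OF L[OF that]]]
    also have "(w' x - (p x - (Y x)\<^sup>2 / 2) / (\<nu> * (1 - x\<^sup>2))) * exp (L x)
        + exp (L x) * (Y x / (\<nu> * (1 - x\<^sup>2))) * (w x - Y x) = \<zeta>' x"
      unfolding \<zeta>'_def by (simp only: distrib_left distrib_right mult_ac)
    finally show ?thesis unfolding \<zeta>_def .
  qed
  have \<zeta>'_le: "\<zeta>' x \<le> - ((\<zeta> x)\<^sup>2 * exp (- L x) / (2 * \<nu> * (1 - x\<^sup>2)))" if x: "x \<in> {-1<..<1}" for x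
  proof -
    note pos = one_minus_sq_pos[OF x]
    have "\<nu> * (1 - x\<^sup>2) * (w' x - (p x - (Y x)\<^sup>2 / 2) / (\<nu> * (1 - x\<^sup>2))
            + (w x - Y x) * (Y x / (\<nu> * (1 - x\<^sup>2))))
        = \<nu> * (1 - x\<^sup>2) * w' x - (p x - (Y x)\<^sup>2 / 2) + (w x - Y x) * Y x"
      using pos assms(1) by (simp add: divide_simps)
    also have "\<dots> \<le> - (w x - Y x)\<^sup>2 / 2"
      using sub[OF x] by (simp add: power2_eq_square algebra_simps)
    finally have "w' x - (p x - (Y x)\<^sup>2 / 2) / (\<nu> * (1 - x\<^sup>2))
            + (w x - Y x) * (Y x / (\<nu> * (1 - x\<^sup>2))) \<le> (- (w x - Y x)\<^sup>2 / 2) / (\<nu> * (1 - x\<^sup>2))"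
      using pos assms(1) by (subst pos_le_divide_eq) (auto simp: mult_ac)
    hence "\<zeta>' x \<le> (- (w x - Y x)\<^sup>2 / 2) / (\<nu> * (1 - x\<^sup>2)) * exp (L x)"
      unfolding \<zeta>'_def by (intro mult_right_mono) auto
    also have "\<dots> = - ((\<zeta> x)\<^sup>2 * exp (- L x) / (2 * \<nu> * (1 - x\<^sup>2)))"
    proof -
      have "(\<zeta> x)\<^sup>2 * exp (- L x) = (w x - Y x)\<^sup>2 * exp (L x)"
        by (simp add: \<zeta>_def exp_minus power2_eq_square)
      thus ?thesis by simp
    qed
    finally show ?thesis .
  qed
  have \<zeta>0: "\<zeta> x0 > 0" using gt by (simp add: \<zeta>_def)
  have \<zeta>_mono: "\<zeta> x0 \<le> \<zeta> x" if x: "x \<in> {-1<..<1}" "x \<le> x0" for x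
  proof (rule nonincreasing_on_interval[OF x(2) x(1) x0])
    fix t :: real assume t: "t \<in> {-1<..<1}"
    have "0 \<le> (\<zeta> t)\<^sup>2 * exp (- L t) / (2 * \<nu> * (1 - t\<^sup>2))"
      using one_minus_sq_pos[OF t] assms(1) by (intro divide_nonneg_nonneg mult_nonneg_nonneg) auto
    hence "\<zeta>' t \<le> 0" using \<zeta>'_le[OF t] by linarith
    thus "\<exists>d\<le>0. (\<zeta> has_real_derivative d) (at t)" using \<zeta>[OF t] by blast
  qed
  \<comment> \<open>With this \<open>K\<close> the competing solution passes through \<open>w x0\<close> at \<open>x0\<close>.\<close>
  define K where "K = 2 * \<nu> / \<zeta> x0 - I x0"
  have KI: "K + I x > 0" if x: "x \<in> {-1<..<1}" for x
  proof (cases "x \<le> x0")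
    case True
    have "I x0 - 2 * \<nu> / \<zeta> x0 \<le> I x - 2 * \<nu> / \<zeta> x"
    proof (rule nonincreasing_on_interval[OF True x x0])
      fix t :: real assume t: "t \<in> {-1<..<1}" "t \<le> x0"
      note pos = one_minus_sq_pos[OF t(1)]
      have z: "\<zeta> t > 0" using \<zeta>_mono[OF t] \<zeta>0 by linarith
      have d: "((\<lambda>t. I t - 2 * \<nu> / \<zeta> t) has_real_derivative
              exp (- L t) / (1 - t\<^sup>2) + 2 * \<nu> * \<zeta>' t / (\<zeta> t)\<^sup>2) (at t)"
        using z by (auto intro!: derivative_eq_intros I[OF t(1)] \<zeta>[OF t(1)] simp: power2_eq_square)
      have "2 * \<nu> * \<zeta>' t / (\<zeta> t)\<^sup>2
          \<le> 2 * \<nu> * (- ((\<zeta> t)\<^sup>2 * exp (- L t) / (2 * \<nu> * (1 - t\<^sup>2)))) / (\<zeta> t)\<^sup>2"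
        using \<zeta>'_le[OF t(1)] assms(1) by (intro divide_right_mono mult_left_mono) auto
      also have "\<dots> = - (exp (- L t) / (1 - t\<^sup>2))"
        using z assms(1) pos by (simp add: divide_simps)
      finally show "\<exists>d\<le>0. ((\<lambda>t. I t - 2 * \<nu> / \<zeta> t) has_real_derivative d) (at t)"
        using d by (intro exI[of _ "exp (- L t) / (1 - t\<^sup>2) + 2 * \<nu> * \<zeta>' t / (\<zeta> t)\<^sup>2"]) auto
    qed
    moreover have "2 * \<nu> / \<zeta> x > 0"
      using \<zeta>_mono[OF x True] \<zeta>0 assms(1) by (intro divide_pos_pos) auto
    ultimately show ?thesis by (simp add: K_def)
  next
    case False
    hence "x0 \<le> x" by simp
    have "- I x \<le> - I x0"
    proof (rule nonincreasing_on_interval[OF \<open>x0 \<le> x\<close> x0 x])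
      fix t :: real assume t: "t \<in> {-1<..<1}"
      show "\<exists>d\<le>0. ((\<lambda>x. - I x) has_real_derivative d) (at t)"
        using DERIV_minus[OF I[OF t]] one_minus_sq_pos[OF t]
        by (intro exI[of _ "- (exp (- L t) / (1 - t\<^sup>2))"]) auto
    qed
    moreover have "2 * \<nu> / \<zeta> x0 > 0" using \<zeta>0 assms(1) by simp
    ultimately show ?thesis by (simp add: K_def)
  qed
  define V where "V = (\<lambda>x. Y x + 2 * \<nu> * exp (- L x) / (K + I x))"
  have "riccati \<nu> p V"
    unfolding riccati_def
  proof
    fix x :: real assume x: "x \<in> {-1<..<1}"
    note pos = one_minus_sq_pos[OF x]
    have "(V has_real_derivative (p x - (Y x)\<^sup>2 / 2) / (\<nu> * (1 - x\<^sup>2))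
       + (2 * \<nu> * (exp (- L x) * (- (Y x / (\<nu> * (1 - x\<^sup>2))))) * (K + I x)
          - 2 * \<nu> * exp (- L x) * (exp (- L x) / (1 - x\<^sup>2))) / (K + I x)\<^sup>2) (at x)"
      unfolding V_def using KI[OF x] assms(1)
      by (auto intro!: derivative_eq_intros Yd[OF x] L[OF x] I[OF x] simp: power2_eq_square)
    also have "(p x - (Y x)\<^sup>2 / 2) / (\<nu> * (1 - x\<^sup>2))
       + (2 * \<nu> * (exp (- L x) * (- (Y x / (\<nu> * (1 - x\<^sup>2))))) * (K + I x)
          - 2 * \<nu> * exp (- L x) * (exp (- L x) / (1 - x\<^sup>2))) / (K + I x)\<^sup>2
       = (p x - (V x)\<^sup>2 / 2) / (\<nu> * (1 - x\<^sup>2))"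
      unfolding V_def using assms(1) pos KI[OF x] by (rule riccati_shift_identity)
    finally show "(V has_real_derivative (p x - (V x)\<^sup>2 / 2) / (\<nu> * (1 - x\<^sup>2))) (at x)" .
  qed
  from maximal[OF this x0] have "2 * \<nu> * exp (- L x0) / (K + I x0) \<le> 0"
    by (simp add: V_def)
  moreover have "2 * \<nu> * exp (- L x0) / (K + I x0) > 0"
    using KI[OF x0] assms(1) by (intro divide_pos_pos mult_pos_pos) auto
  ultimately show False by linarith
qed

text \<open>
  The maximum principle in its simplest form: a function cannot cross a level upwards if it does not
  increase above that level. Read contrapositively, a function above the level at \<open>x1\<close> has been above it
  since \<open>x0\<close>.
\<close>

lemma stays_below_level:
  fixes y :: "real \<Rightarrow> real"
  assumes "x0 \<le> x1" and "y x0 \<le> K"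
    and y: "\<And>x. x0 \<le> x \<Longrightarrow> x \<le> x1 \<Longrightarrow> (y has_real_derivative y' x) (at x)"
    and dec: "\<And>x. x0 \<le> x \<Longrightarrow> x \<le> x1 \<Longrightarrow> y x > K \<Longrightarrow> y' x \<le> 0"
  shows "y x1 \<le> K"
proof (rule ccontr)
  assume "\<not> y x1 \<le> K"
  define A where "A = {x0..x1} \<inter> {x. y x \<le> K}"
  have cont: "continuous_on {x0..x1} y"
    using DERIV_isCont[OF y] by (intro continuous_at_imp_continuous_on) auto
  have "closed A"
    unfolding A_def using continuous_closed_preimage[OF cont closed_atLeastAtMost closed_atMost[of K]]
    by (simp add: vimage_def)
  hence "compact A" unfolding compact_eq_bounded_closed
    by (auto simp: A_def intro: bounded_subset[OF bounded_closed_interval[of x0 x1]])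
  moreover have "A \<noteq> {}" using assms(1,2) by (auto simp: A_def)
  ultimately obtain s where s: "s \<in> A" "\<And>t. t \<in> A \<Longrightarrow> t \<le> s"
    using compact_attains_sup[of A] by auto
  have "s < x1" using s(1) \<open>\<not> y x1 \<le> K\<close> by (cases "s = x1") (auto simp: A_def)
  have "y x1 \<le> y s"
  proof (rule DERIV_nonpos_imp_decreasing_open[where f = y])
    show "s \<le> x1" using \<open>s < x1\<close> by simp
    fix x assume x: "s < x" "x < x1"
    have "x \<notin> A" using s(2)[of x] x by auto
    hence "y x > K" using x s(1) by (auto simp: A_def)
    thus "\<exists>d. (y has_real_derivative d) (at x) \<and> d \<le> 0"
      using y[of x] dec[of x] x s(1) by (auto simp: A_def)
  next
    show "continuous_on {s..x1} y"
      using s(1) by (intro continuous_on_subset[OF cont]) (auto simp: A_def)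
  qed
  thus False using s(1) \<open>\<not> y x1 \<le> K\<close> by (auto simp: A_def)
qed

text \<open>
  Where \<open>\<zeta> = Y - W\<close> is positive it satisfies \<open>\<zeta>' \<le> - \<zeta>\<^sup>2 / (2 \<nu> (1 - x\<^sup>2))\<close>. Going left from a point
  with \<open>\<zeta> > 0\<close> it therefore stays positive and blows up before \<open>-1\<close> is reached, because
  \<open>1 / (1 - x\<^sup>2)\<close> is not integrable there; but \<open>Y\<close> is finite on the whole interval.
\<close>

lemma solution_le_supersolution:
  assumes "\<nu> > 0" and Y: "riccati \<nu> p Y"
    and W: "\<And>x. x \<in> {-1<..<1} \<Longrightarrow> (W has_real_derivative W' x) (at x)"
    and super: "\<And>x. x \<in> {-1<..<1} \<Longrightarrow> \<nu> * (1 - x\<^sup>2) * W' x + (W x)\<^sup>2 / 2 \<ge> p x"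
    and nonneg: "\<And>x. x \<in> {-1<..<1} \<Longrightarrow> W x \<ge> 0"
    and x0: "x0 \<in> {-1<..<1}"
  shows "Y x0 \<le> W x0"
proof (rule ccontr)
  assume "\<not> ?thesis"
  hence gt: "Y x0 - W x0 > 0" by simp
  define \<zeta> where "\<zeta> = (\<lambda>x. Y x - W x)"
  define \<zeta>' where "\<zeta>' = (\<lambda>x. (p x - (Y x)\<^sup>2 / 2) / (\<nu> * (1 - x\<^sup>2)) - W' x)"
  have \<zeta>: "(\<zeta> has_real_derivative \<zeta>' x) (at x)" if "x \<in> {-1<..<1}" for x
    unfolding \<zeta>_def \<zeta>'_def using Y that by (auto simp: riccati_def intro!: DERIV_diff W[OF that])
  have \<zeta>'_le: "\<zeta>' x \<le> - ((\<zeta> x)\<^sup>2 / (2 * \<nu> * (1 - x\<^sup>2)))"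
    if x: "x \<in> {-1<..<1}" and z: "\<zeta> x > 0" for x
  proof -
    note pos = one_minus_sq_pos[OF x]
    have "0 \<le> W x * \<zeta> x" using nonneg[OF x] z by simp
    moreover have "\<nu> * (1 - x\<^sup>2) * \<zeta>' x = p x - (Y x)\<^sup>2 / 2 - \<nu> * (1 - x\<^sup>2) * W' x"
      unfolding \<zeta>'_def right_diff_distrib using pos assms(1) by simp
    ultimately have "\<nu> * (1 - x\<^sup>2) * \<zeta>' x \<le> - (\<zeta> x)\<^sup>2 / 2"
      using super[OF x] unfolding \<zeta>_def
      by (simp add: power2_eq_square algebra_simps)
    hence "\<zeta>' x \<le> (- (\<zeta> x)\<^sup>2 / 2) / (\<nu> * (1 - x\<^sup>2))"
      using pos assms(1) by (subst pos_le_divide_eq) (auto simp: mult_ac)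
    thus ?thesis by (simp add: field_simps)
  qed
  have \<zeta>0: "\<zeta> x0 > 0" using gt by (simp add: \<zeta>_def)
  have \<zeta>_pos: "\<zeta> x > 0" if x: "x \<in> {-1<..<1}" "x \<le> x0" for x
  proof (rule ccontr)
    assume "\<not> \<zeta> x > 0"
    have "\<zeta> x0 \<le> 0"
    proof (rule stays_below_level[OF x(2), of \<zeta> 0 \<zeta>'])
      fix t assume t: "x \<le> t" "t \<le> x0"
      hence t': "t \<in> {-1<..<1}" using x x0 by auto
      show "(\<zeta> has_real_derivative \<zeta>' t) (at t)" using \<zeta>[OF t'] .
      assume "\<zeta> t > 0"
      moreover have "0 \<le> (\<zeta> t)\<^sup>2 / (2 * \<nu> * (1 - t\<^sup>2))"
        using one_minus_sq_pos[OF t'] assms(1) by simp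
      ultimately show "\<zeta>' t \<le> 0" using \<zeta>'_le[OF t'] by linarith
    qed (use \<open>\<not> \<zeta> x > 0\<close> in auto)
    thus False using \<zeta>0 by simp
  qed
  define l where "l = (\<lambda>x::real. (ln (1 + x) - ln (1 - x)) / (4 * \<nu>))"
  have bound: "l x0 - 1 / \<zeta> x0 < l x" if x: "x \<in> {-1<..<1}" "x \<le> x0" for x
  proof -
    have "l x0 - 1 / \<zeta> x0 \<le> l x - 1 / \<zeta> x"
    proof (rule nonincreasing_on_interval[OF x(2) x(1) x0])
      fix t :: real assume t: "t \<in> {-1<..<1}" "t \<le> x0"
      note pos = one_minus_sq_pos[OF t(1)]
      have z: "\<zeta> t > 0" using \<zeta>_pos[OF t] .
      have "((\<lambda>x. ln (1 + x) - ln (1 - x)) has_real_derivative 1 / (1 + t) + 1 / (1 - t)) (at t)"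
        using t(1) by (auto intro!: derivative_eq_intros)
      hence l': "(l has_real_derivative (1 / (1 + t) + 1 / (1 - t)) / (4 * \<nu>)) (at t)"
        unfolding l_def by (rule DERIV_cdivide)
      have "((\<lambda>t. l t - 1 / \<zeta> t) has_real_derivative
             (1 / (1 + t) + 1 / (1 - t)) / (4 * \<nu>) + \<zeta>' t / (\<zeta> t)\<^sup>2) (at t)"
        using z by (auto intro!: derivative_eq_intros l' \<zeta>[OF t(1)] simp: power2_eq_square)
      also have "(1 / (1 + t) + 1 / (1 - t)) / (4 * \<nu>) = 1 / (2 * \<nu> * (1 - t\<^sup>2))"
      proof -
        have "1 - t\<^sup>2 = (1 + t) * (1 - t)" by (simp add: power2_eq_square algebra_simps)
        moreover have "1 + t \<noteq> 0" "1 - t \<noteq> 0" using t(1) by auto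
        ultimately show ?thesis using assms(1) by (simp add: divide_simps)
      qed
      finally have d: "((\<lambda>t. l t - 1 / \<zeta> t) has_real_derivative
             1 / (2 * \<nu> * (1 - t\<^sup>2)) + \<zeta>' t / (\<zeta> t)\<^sup>2) (at t)" .
      have "\<zeta>' t / (\<zeta> t)\<^sup>2 \<le> - ((\<zeta> t)\<^sup>2 / (2 * \<nu> * (1 - t\<^sup>2))) / (\<zeta> t)\<^sup>2"
        using \<zeta>'_le[OF t(1) z] by (intro divide_right_mono) auto
      also have "\<dots> = - (1 / (2 * \<nu> * (1 - t\<^sup>2)))" using z by simp
      finally show "\<exists>d\<le>0. ((\<lambda>t. l t - 1 / \<zeta> t) has_real_derivative d) (at t)"
        using d by (intro exI[of _ "1 / (2 * \<nu> * (1 - t\<^sup>2)) + \<zeta>' t / (\<zeta> t)\<^sup>2"]) auto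
    qed
    moreover have "1 / \<zeta> x > 0" using \<zeta>_pos[OF x] by simp
    ultimately show ?thesis by linarith
  qed
  \<comment> \<open>\<open>l\<close> tends to \<open>-\<infinity>\<close> at \<open>-1\<close>, so it violates the bound at a point close to \<open>-1\<close>.\<close>
  define B where "B = l x0 - 1 / \<zeta> x0"
  define x where "x = min (min x0 0) (exp (4 * \<nu> * B) - 1)"
  have x: "x \<in> {-1<..<1}" "x \<le> x0" "x \<le> 0"
  proof -
    have "-1 < x" using x0 unfolding x_def min_less_iff_conj by simp
    moreover show "x \<le> x0" "x \<le> 0" unfolding x_def by auto
    ultimately show "x \<in> {-1<..<1}" by simp
  qed
  have "ln (1 + x) \<le> ln (exp (4 * \<nu> * B))"
  proof (subst ln_le_cancel_iff)
    show "1 + x \<le> exp (4 * \<nu> * B)" unfolding x_def by linarith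
  qed (use x in auto)
  moreover have "ln (1 - x) \<ge> 0" using x by simp
  ultimately have "ln (1 + x) - ln (1 - x) \<le> 4 * \<nu> * B" by simp
  hence "l x \<le> B" using assms(1) by (simp add: l_def field_simps)
  thus False using bound[OF x(1,2)] by (simp add: B_def)
qed

text \<open>
  The functions \<open>R - a\<close> and \<open>R + a\<close> with \<open>R = sqrt (2 p + a\<^sup>2)\<close> are a subsolution and a
  supersolution: \<open>(R \<mp> a)\<^sup>2 / 2 = p \<mp> a (R \<mp> a)\<close>, and since \<open>R' = p' / R\<close> and
  \<open>(R - a) R \<ge> p \<ge> \<kappa> (1 - x\<^sup>2)\<close>, the term \<open>\<nu> (1 - x\<^sup>2) R'\<close> is at most \<open>a (R - a)\<close> in absolute value
  for \<open>a = M \<nu> / \<kappa>\<close>. The summand \<open>a\<^sup>2\<close> keeps \<open>R\<close> smooth up to the endpoints, where \<open>p\<close> may vanish.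
\<close>

lemma maximal_solution_near_sqrt:
  assumes "\<nu> > 0" "\<kappa> > 0" "M > 0" and max: "maximal_riccati \<nu> p Y"
    and p: "\<And>x. x \<in> {-1<..<1} \<Longrightarrow> (p has_real_derivative p' x) (at x)"
    and p': "\<And>x. x \<in> {-1<..<1} \<Longrightarrow> \<bar>p' x\<bar> \<le> M"
    and lower: "\<And>x. x \<in> {-1<..<1} \<Longrightarrow> \<kappa> * (1 - x\<^sup>2) \<le> p x"
    and x: "x \<in> {-1<..<1}"
  defines "a \<equiv> M / \<kappa> * \<nu>"
  shows "0 \<le> Y x" and "\<bar>Y x - sqrt (2 * p x + a\<^sup>2)\<bar> \<le> a"
proof -
  have Y: "riccati \<nu> p Y" using max by (simp add: maximal_riccati_def)
  define R where "R = (\<lambda>x. sqrt (2 * p x + a\<^sup>2))"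
  have a: "a > 0" using assms by (simp add: a_def)
  have p0: "p x \<ge> 0" if "x \<in> {-1<..<1}" for x
    using lower[OF that] one_minus_sq_pos[OF that] assms(2)
    by (meson less_imp_le mult_nonneg_nonneg order_trans)
  have R2: "(R x)\<^sup>2 = 2 * p x + a\<^sup>2" if "x \<in> {-1<..<1}" for x
    using p0[OF that] by (simp add: R_def)
  have Ra: "R x \<ge> a" if "x \<in> {-1<..<1}" for x
    unfolding R_def using p0[OF that] a by (intro real_le_rsqrt) simp
  have R': "(R has_real_derivative p' x / R x) (at x)" if x: "x \<in> {-1<..<1}" for x
  proof -
    have "2 * p x + a\<^sup>2 > 0" using p0[OF x] a by (intro add_nonneg_pos) auto
    thus ?thesis unfolding R_def
      by (auto intro!: derivative_eq_intros p[OF x] simp: divide_simps)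
  qed
  have key: "\<nu> * (1 - x\<^sup>2) * \<bar>p' x / R x\<bar> \<le> a * (R x - a)" if x: "x \<in> {-1<..<1}" for x
  proof -
    note pos = one_minus_sq_pos[OF x]
    have R0: "R x > 0" using Ra[OF x] a by linarith
    have "p x \<le> (R x - a) * R x"
    proof -
      have "2 * p x = (R x - a) * (R x + a)"
        using R2[OF x] by (simp add: power2_eq_square algebra_simps)
      also have "\<dots> \<le> (R x - a) * (2 * R x)" using Ra[OF x] by (intro mult_left_mono) auto
      finally show ?thesis by simp
    qed
    have "\<nu> * (1 - x\<^sup>2) * \<bar>p' x\<bar> \<le> \<nu> * (1 - x\<^sup>2) * M"
      using p'[OF x] pos assms(1) by (intro mult_left_mono) auto
    also have "\<dots> = a * (\<kappa> * (1 - x\<^sup>2))" using assms(2) by (simp add: a_def)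
    also have "\<dots> \<le> a * p x" using lower[OF x] a by (intro mult_left_mono) auto
    also have "\<dots> \<le> a * ((R x - a) * R x)"
      using \<open>p x \<le> (R x - a) * R x\<close> a by (intro mult_left_mono) auto
    finally show ?thesis using R0 by (simp add: field_simps)
  qed
  have Rpos: "R x \<ge> 0" if "x \<in> {-1<..<1}" for x using Ra[OF that] a by linarith
  have key2: "\<bar>\<nu> * (1 - x\<^sup>2) * (p' x / R x)\<bar> \<le> a * (R x - a)" if x: "x \<in> {-1<..<1}" for x
    using key[OF x] one_minus_sq_pos[OF x] assms(1) by (simp add: abs_mult)
  have minus_sq: "(R x - a)\<^sup>2 / 2 = p x - a * (R x - a)" if x: "x \<in> {-1<..<1}" for x
    using R2[OF x] by (simp add: power2_eq_square field_simps)
  have plus_sq: "(R x + a)\<^sup>2 / 2 = p x + a * (R x + a)" if x: "x \<in> {-1<..<1}" for x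
    using R2[OF x] by (simp add: power2_eq_square field_simps)
  have "R x - a \<le> Y x"
  proof (rule subsolution_le_maximal[OF assms(1) max, where w' = "\<lambda>x. p' x / R x"])
    fix x :: real assume x: "x \<in> {-1<..<1}"
    show "((\<lambda>x. R x - a) has_real_derivative p' x / R x) (at x)"
      using R'[OF x] by (auto intro!: derivative_eq_intros)
    show "\<nu> * (1 - x\<^sup>2) * (p' x / R x) + (R x - a)\<^sup>2 / 2 \<le> p x"
      using abs_le_D1[OF key2[OF x]] minus_sq[OF x] by linarith
  qed (use x in auto)
  moreover have "Y x \<le> R x + a"
  proof (rule solution_le_supersolution[OF assms(1) Y, where W' = "\<lambda>x. p' x / R x"])
    fix x :: real assume x: "x \<in> {-1<..<1}"
    show "((\<lambda>x. R x + a) has_real_derivative p' x / R x) (at x)"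
      using R'[OF x] by (auto intro!: derivative_eq_intros)
    have "a * (R x - a) \<le> a * (R x + a)" using a by (intro mult_left_mono) auto
    thus "\<nu> * (1 - x\<^sup>2) * (p' x / R x) + (R x + a)\<^sup>2 / 2 \<ge> p x"
      using abs_le_D2[OF key2[OF x]] plus_sq[OF x] by linarith
    show "R x + a \<ge> 0" using Rpos[OF x] a by simp
  qed (use x in auto)
  ultimately show "\<bar>Y x - sqrt (2 * p x + a\<^sup>2)\<bar> \<le> a" "0 \<le> Y x"
    using Ra[OF x] by (auto simp: R_def)
qed

section \<open>Families with uniformly bounded derivatives\<close>

text \<open>
  The family \<open>f i\<close> has derivatives of order up to \<open>m\<close> that are bounded on \<open>S\<close> by a constant independent
  of \<open>i\<close>, eventually along \<open>F\<close>. The recursion on \<open>m\<close> reduces every closure property to the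
  first-order product, quotient and chain rules, so that no Leibniz formula is needed.
\<close>

primrec bdd_derivs :: "nat \<Rightarrow> 'i filter \<Rightarrow> real set \<Rightarrow> ('i \<Rightarrow> real \<Rightarrow> real) \<Rightarrow> bool" where
  "bdd_derivs 0 F S f \<longleftrightarrow> (\<exists>C. \<forall>\<^sub>F i in F. \<forall>x\<in>S. \<bar>f i x\<bar> \<le> C)"
| "bdd_derivs (Suc m) F S f \<longleftrightarrow>
     (\<exists>C. \<forall>\<^sub>F i in F. \<forall>x\<in>S. \<bar>f i x\<bar> \<le> C) \<and>
     (\<forall>\<^sub>F i in F. \<forall>x\<in>S. f i differentiable (at x)) \<and>
     bdd_derivs m F S (\<lambda>i. deriv (f i))"

lemma bdd_derivs_imp_bdd:
  "bdd_derivs m F S f \<Longrightarrow> \<exists>C. \<forall>\<^sub>F i in F. \<forall>x\<in>S. \<bar>f i x\<bar> \<le> C"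
  by (cases m) auto

lemma bdd_derivs_SucD: "bdd_derivs (Suc m) F S f \<Longrightarrow> bdd_derivs m F S f"
  by (induction m arbitrary: f) auto

lemma bdd_derivs_subset:
  assumes "S' \<subseteq> S"
  shows "bdd_derivs m F S f \<Longrightarrow> bdd_derivs m F S' f"
proof (induction m arbitrary: f)
  case 0
  then obtain C where "\<forall>\<^sub>F i in F. \<forall>x\<in>S. \<bar>f i x\<bar> \<le> C" by auto
  hence "\<forall>\<^sub>F i in F. \<forall>x\<in>S'. \<bar>f i x\<bar> \<le> C" by eventually_elim (use assms in auto)
  thus ?case by auto
next
  case (Suc m)
  from Suc.prems obtain C where "\<forall>\<^sub>F i in F. \<forall>x\<in>S. \<bar>f i x\<bar> \<le> C" by auto
  hence "\<forall>\<^sub>F i in F. \<forall>x\<in>S'. \<bar>f i x\<bar> \<le> C" by eventually_elim (use assms in auto)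
  moreover from Suc.prems have "\<forall>\<^sub>F i in F. \<forall>x\<in>S. f i differentiable (at x)" by auto
  hence "\<forall>\<^sub>F i in F. \<forall>x\<in>S'. f i differentiable (at x)" by eventually_elim (use assms in auto)
  ultimately show ?case using Suc by auto
qed

lemma deriv_eq_on_open:
  fixes f g :: "real \<Rightarrow> real"
  assumes "open S" "x \<in> S" "\<And>y. y \<in> S \<Longrightarrow> f y = g y"
  shows "deriv f x = deriv g x"
  by (rule deriv_cong_ev) (use assms eventually_nhds in blast)+

lemma differentiable_eq_on_open:
  fixes f g :: "real \<Rightarrow> real"
  assumes "open S" "x \<in> S" "\<And>y. y \<in> S \<Longrightarrow> f y = g y" "f differentiable (at x)"
  shows "g differentiable (at x)"
proof -
  obtain d where "(f has_real_derivative d) (at x)"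
    using assms(4) by (auto simp: real_differentiable_def)
  hence "(g has_real_derivative d) (at x)"
    using has_field_derivative_transform_within_open[OF _ assms(1,2)] assms(3) by blast
  thus ?thesis by (auto simp: real_differentiable_def)
qed

lemma bdd_derivs_cong:
  assumes "open S"
  shows "bdd_derivs m F S f \<Longrightarrow> \<forall>\<^sub>F i in F. \<forall>x\<in>S. f i x = g i x \<Longrightarrow> bdd_derivs m F S g"
proof (induction m arbitrary: f g)
  case 0
  then obtain C where "\<forall>\<^sub>F i in F. \<forall>x\<in>S. \<bar>f i x\<bar> \<le> C" by auto
  hence "\<forall>\<^sub>F i in F. \<forall>x\<in>S. \<bar>g i x\<bar> \<le> C" using 0(2) by eventually_elim auto
  thus ?case by auto
next
  case (Suc m)
  from Suc.prems obtain C where "\<forall>\<^sub>F i in F. \<forall>x\<in>S. \<bar>f i x\<bar> \<le> C" by auto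
  hence "\<forall>\<^sub>F i in F. \<forall>x\<in>S. \<bar>g i x\<bar> \<le> C" using Suc.prems(2) by eventually_elim auto
  moreover from Suc.prems(1) have "\<forall>\<^sub>F i in F. \<forall>x\<in>S. f i differentiable (at x)" by auto
  hence "\<forall>\<^sub>F i in F. \<forall>x\<in>S. g i differentiable (at x)"
    using Suc.prems(2)
    by eventually_elim (use differentiable_eq_on_open[OF assms] in blast)
  moreover have "\<forall>\<^sub>F i in F. \<forall>x\<in>S. deriv (f i) x = deriv (g i) x"
    using Suc.prems(2)
    by eventually_elim (use deriv_eq_on_open[OF assms] in blast)
  ultimately show ?case using Suc by auto
qed

lemma bdd_derivs_const:
  assumes "\<forall>\<^sub>F i in F. \<bar>k i\<bar> \<le> C"
  shows "bdd_derivs m F S (\<lambda>i x. k i)"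
  using assms
proof (induction m arbitrary: k C)
  case 0
  thus ?case by auto
next
  case (Suc m)
  have "bdd_derivs m F S (\<lambda>i x. 0)" by (rule Suc.IH[of _ 0]) simp
  moreover have "\<exists>C. \<forall>\<^sub>F i in F. \<forall>x\<in>S. \<bar>k i\<bar> \<le> C"
    using Suc.prems by (intro exI[of _ C]) (auto elim: eventually_mono)
  ultimately show ?case by (simp add: deriv_const)
qed

lemma bdd_derivs_ident:
  assumes "S \<subseteq> {-1..1}"
  shows "bdd_derivs m F S (\<lambda>i x. x)"
proof (cases m)
  case 0
  have "\<exists>C. \<forall>\<^sub>F i in F. \<forall>x\<in>S. \<bar>x\<bar> \<le> C"
    using assms by (intro exI[of _ 1] always_eventually) (force simp: abs_le_iff)
  thus ?thesis using 0 by simp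
next
  case (Suc n)
  have "bdd_derivs n F S (\<lambda>i x. 1)" by (rule bdd_derivs_const[where C = 1]) simp
  moreover have "\<exists>C. \<forall>\<^sub>F i in F. \<forall>x\<in>S. \<bar>x\<bar> \<le> C"
    using assms by (intro exI[of _ 1] always_eventually) (force simp: abs_le_iff)
  moreover have "deriv (\<lambda>x::real. x) = (\<lambda>x. 1)" by (intro ext DERIV_imp_deriv) auto
  ultimately show ?thesis using Suc by simp
qed

lemma has_real_derivative_deriv:
  fixes f :: "real \<Rightarrow> real"
  shows "f differentiable (at x) \<Longrightarrow> (f has_real_derivative deriv f x) (at x)"
  by (simp add: DERIV_deriv_iff_real_differentiable)

lemma bdd_derivs_add:
  assumes "open S"
  shows "bdd_derivs m F S f \<Longrightarrow> bdd_derivs m F S g \<Longrightarrow> bdd_derivs m F S (\<lambda>i x. f i x + g i x)"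
proof (induction m arbitrary: f g)
  case (0 f g)
  then obtain C D where "\<forall>\<^sub>F i in F. \<forall>x\<in>S. \<bar>f i x\<bar> \<le> C" "\<forall>\<^sub>F i in F. \<forall>x\<in>S. \<bar>g i x\<bar> \<le> D" by auto
  hence "\<forall>\<^sub>F i in F. \<forall>x\<in>S. \<bar>f i x + g i x\<bar> \<le> C + D"
    by eventually_elim (use abs_triangle_ineq add_mono order_trans in meson)
  thus ?case by auto
next
  case (Suc m f g)
  from Suc.prems obtain C D where
    "\<forall>\<^sub>F i in F. \<forall>x\<in>S. \<bar>f i x\<bar> \<le> C" "\<forall>\<^sub>F i in F. \<forall>x\<in>S. \<bar>g i x\<bar> \<le> D" by auto
  hence "\<forall>\<^sub>F i in F. \<forall>x\<in>S. \<bar>f i x + g i x\<bar> \<le> C + D"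
    by eventually_elim (use abs_triangle_ineq add_mono order_trans in meson)
  moreover from Suc.prems have d: "\<forall>\<^sub>F i in F. \<forall>x\<in>S. f i differentiable (at x)"
    "\<forall>\<^sub>F i in F. \<forall>x\<in>S. g i differentiable (at x)" by auto
  hence "\<forall>\<^sub>F i in F. \<forall>x\<in>S. (\<lambda>x. f i x + g i x) differentiable (at x)"
    by eventually_elim auto
  moreover have "\<forall>\<^sub>F i in F. \<forall>x\<in>S. deriv (f i) x + deriv (g i) x = deriv (\<lambda>x. f i x + g i x) x"
    using d
  proof eventually_elim
    case (elim i)
    show ?case
    proof
      fix x assume "x \<in> S"
      hence "((\<lambda>x. f i x + g i x) has_real_derivative deriv (f i) x + deriv (g i) x) (at x)"
        using elim by (intro DERIV_add has_real_derivative_deriv) auto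
      thus "deriv (f i) x + deriv (g i) x = deriv (\<lambda>x. f i x + g i x) x"
        by (rule DERIV_imp_deriv[symmetric])
    qed
  qed
  moreover have "bdd_derivs m F S (\<lambda>i x. deriv (f i) x + deriv (g i) x)"
    using Suc by auto
  ultimately show ?case
    using bdd_derivs_cong[OF assms, of m F "\<lambda>i x. deriv (f i) x + deriv (g i) x"
        "\<lambda>i. deriv (\<lambda>x. f i x + g i x)"]
    by auto
qed

lemma bdd_derivs_mult:
  assumes "open S"
  shows "bdd_derivs m F S f \<Longrightarrow> bdd_derivs m F S g \<Longrightarrow> bdd_derivs m F S (\<lambda>i x. f i x * g i x)"
proof (induction m arbitrary: f g)
  case (0 f g)
  then obtain C D where "\<forall>\<^sub>F i in F. \<forall>x\<in>S. \<bar>f i x\<bar> \<le> C" "\<forall>\<^sub>F i in F. \<forall>x\<in>S. \<bar>g i x\<bar> \<le> D" by auto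
  hence "\<forall>\<^sub>F i in F. \<forall>x\<in>S. \<bar>f i x * g i x\<bar> \<le> \<bar>C\<bar> * \<bar>D\<bar>"
    by eventually_elim (auto simp: abs_mult intro!: mult_mono intro: order_trans[OF _ abs_ge_self])
  thus ?case by auto
next
  case (Suc m f g)
  from Suc.prems obtain C D where
    "\<forall>\<^sub>F i in F. \<forall>x\<in>S. \<bar>f i x\<bar> \<le> C" "\<forall>\<^sub>F i in F. \<forall>x\<in>S. \<bar>g i x\<bar> \<le> D" by auto
  hence "\<forall>\<^sub>F i in F. \<forall>x\<in>S. \<bar>f i x * g i x\<bar> \<le> \<bar>C\<bar> * \<bar>D\<bar>"
    by eventually_elim (auto simp: abs_mult intro!: mult_mono intro: order_trans[OF _ abs_ge_self])
  moreover from Suc.prems have d: "\<forall>\<^sub>F i in F. \<forall>x\<in>S. f i differentiable (at x)"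
    "\<forall>\<^sub>F i in F. \<forall>x\<in>S. g i differentiable (at x)" by auto
  hence "\<forall>\<^sub>F i in F. \<forall>x\<in>S. (\<lambda>x. f i x * g i x) differentiable (at x)"
    by eventually_elim auto
  moreover have "\<forall>\<^sub>F i in F. \<forall>x\<in>S.
      deriv (f i) x * g i x + deriv (g i) x * f i x = deriv (\<lambda>x. f i x * g i x) x"
    using d
  proof eventually_elim
    case (elim i)
    show ?case
    proof
      fix x assume "x \<in> S"
      hence "((\<lambda>x. f i x * g i x) has_real_derivative
               deriv (f i) x * g i x + deriv (g i) x * f i x) (at x)"
        using elim by (intro DERIV_mult has_real_derivative_deriv) auto
      thus "deriv (f i) x * g i x + deriv (g i) x * f i x = deriv (\<lambda>x. f i x * g i x) x"
        by (rule DERIV_imp_deriv[symmetric])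
    qed
  qed
  moreover have "bdd_derivs m F S (\<lambda>i x. deriv (f i) x * g i x + deriv (g i) x * f i x)"
    using Suc.prems bdd_derivs_SucD[OF Suc.prems(1)] bdd_derivs_SucD[OF Suc.prems(2)]
    by (intro bdd_derivs_add[OF assms] Suc.IH) auto
  ultimately show ?case
    using bdd_derivs_cong[OF assms, of m F
        "\<lambda>i x. deriv (f i) x * g i x + deriv (g i) x * f i x"
        "\<lambda>i. deriv (\<lambda>x. f i x * g i x)"]
    by auto
qed

lemma bdd_derivs_diff:
  assumes "open S" "bdd_derivs m F S f" "bdd_derivs m F S g"
  shows "bdd_derivs m F S (\<lambda>i x. f i x - g i x)"
proof -
  have "bdd_derivs m F S (\<lambda>i x. f i x + (-1) * g i x)"
    using assms by (intro bdd_derivs_add bdd_derivs_mult bdd_derivs_const[where C = 1]) auto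
  thus ?thesis by simp
qed

lemma bdd_derivs_inverse:
  assumes "open S" "\<delta> > 0"
  shows "bdd_derivs m F S f \<Longrightarrow> \<forall>\<^sub>F i in F. \<forall>x\<in>S. f i x \<ge> \<delta> \<Longrightarrow>
         bdd_derivs m F S (\<lambda>i x. inverse (f i x))"
proof (induction m)
  case 0
  from 0(2) have "\<forall>\<^sub>F i in F. \<forall>x\<in>S. \<bar>inverse (f i x)\<bar> \<le> inverse \<delta>"
    by eventually_elim (use assms(2) in \<open>auto intro: le_imp_inverse_le simp: abs_if dest: order_less_le_trans\<close>)
  thus ?case by auto
next
  case (Suc m)
  have IH: "bdd_derivs m F S (\<lambda>i x. inverse (f i x))"
    using Suc bdd_derivs_SucD by blast
  from Suc.prems(1) have d: "\<forall>\<^sub>F i in F. \<forall>x\<in>S. f i differentiable (at x)" by auto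
  have inv': "\<forall>\<^sub>F i in F. \<forall>x\<in>S. ((\<lambda>x. inverse (f i x)) has_real_derivative
        (-1) * (deriv (f i) x * (inverse (f i x) * inverse (f i x)))) (at x)"
    using d Suc.prems(2)
  proof eventually_elim
    case (elim i)
    show ?case
    proof
      fix x assume "x \<in> S"
      hence "f i x \<noteq> 0" "(f i has_real_derivative deriv (f i) x) (at x)"
        using elim assms(2) by (force intro: has_real_derivative_deriv)+
      thus "((\<lambda>x. inverse (f i x)) has_real_derivative
          (-1) * (deriv (f i) x * (inverse (f i x) * inverse (f i x)))) (at x)"
        by (auto intro!: derivative_eq_intros)
    qed
  qed
  have "bdd_derivs m F S (\<lambda>i x. (-1) * (deriv (f i) x * (inverse (f i x) * inverse (f i x))))"
    using Suc.prems(1) IH assms(1) by (intro bdd_derivs_mult bdd_derivs_const[where C = 1]) auto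
  hence "bdd_derivs m F S (\<lambda>i. deriv (\<lambda>x. inverse (f i x)))"
    by (rule bdd_derivs_cong[OF assms(1)])
       (use inv' in eventually_elim, use DERIV_imp_deriv in fastforce)
  moreover have "\<forall>\<^sub>F i in F. \<forall>x\<in>S. (\<lambda>x. inverse (f i x)) differentiable (at x)"
    using inv' by eventually_elim (auto simp: real_differentiable_def)
  ultimately show ?case using bdd_derivs_imp_bdd[OF IH] by simp
qed

lemma bdd_derivs_sqrt:
  assumes "open S" "\<delta> > 0"
  shows "bdd_derivs m F S f \<Longrightarrow> \<forall>\<^sub>F i in F. \<forall>x\<in>S. f i x \<ge> \<delta> \<Longrightarrow>
         bdd_derivs m F S (\<lambda>i x. sqrt (f i x))"
proof (induction m)
  case 0
  then obtain C where "\<forall>\<^sub>F i in F. \<forall>x\<in>S. \<bar>f i x\<bar> \<le> C" by auto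
  hence "\<forall>\<^sub>F i in F. \<forall>x\<in>S. \<bar>sqrt (f i x)\<bar> \<le> sqrt C"
    by eventually_elim (auto simp flip: real_sqrt_abs2 real_sqrt_abs simp: real_sqrt_abs)
  thus ?case by auto
next
  case (Suc m)
  have IH: "bdd_derivs m F S (\<lambda>i x. sqrt (f i x))"
    using Suc bdd_derivs_SucD by blast
  from Suc.prems(1) have d: "\<forall>\<^sub>F i in F. \<forall>x\<in>S. f i differentiable (at x)" by auto
  have sqrt': "\<forall>\<^sub>F i in F. \<forall>x\<in>S. ((\<lambda>x. sqrt (f i x)) has_real_derivative
        (1 / 2) * (deriv (f i) x * inverse (sqrt (f i x)))) (at x)"
    using d Suc.prems(2)
  proof eventually_elim
    case (elim i)
    show ?case
    proof
      fix x assume "x \<in> S"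
      hence "f i x > 0" "(f i has_real_derivative deriv (f i) x) (at x)"
        using elim assms(2) by (force intro: has_real_derivative_deriv)+
      thus "((\<lambda>x. sqrt (f i x)) has_real_derivative
          (1 / 2) * (deriv (f i) x * inverse (sqrt (f i x)))) (at x)"
        by (auto intro!: derivative_eq_intros simp: field_simps)
    qed
  qed
  have "\<forall>\<^sub>F i in F. \<forall>x\<in>S. sqrt (f i x) \<ge> sqrt \<delta>"
    using Suc.prems(2) by eventually_elim auto
  hence "bdd_derivs m F S (\<lambda>i x. inverse (sqrt (f i x)))"
    using assms IH by (intro bdd_derivs_inverse[of _ "sqrt \<delta>"]) auto
  hence "bdd_derivs m F S (\<lambda>i x. (1 / 2) * (deriv (f i) x * inverse (sqrt (f i x))))"
    using Suc.prems(1) assms(1) by (intro bdd_derivs_mult bdd_derivs_const[where C = "1 / 2"]) auto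
  hence "bdd_derivs m F S (\<lambda>i. deriv (\<lambda>x. sqrt (f i x)))"
    by (rule bdd_derivs_cong[OF assms(1)])
       (use sqrt' in eventually_elim, use DERIV_imp_deriv in fastforce)
  moreover have "\<forall>\<^sub>F i in F. \<forall>x\<in>S. (\<lambda>x. sqrt (f i x)) differentiable (at x)"
    using sqrt' by eventually_elim (auto simp: real_differentiable_def)
  ultimately show ?case using bdd_derivs_imp_bdd[OF IH] by simp
qed

lemma bdd_derivs_funpow:
  "bdd_derivs (Suc m) F S f \<Longrightarrow>
   \<exists>C. \<forall>\<^sub>F i in F. \<forall>j\<le>m. \<forall>x\<in>S.
         (deriv ^^ j) (f i) differentiable (at x) \<and> \<bar>(deriv ^^ j) (f i) x\<bar> \<le> C"
proof (induction m arbitrary: f)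
  case 0
  then obtain C where "\<forall>\<^sub>F i in F. \<forall>x\<in>S. \<bar>f i x\<bar> \<le> C"
    "\<forall>\<^sub>F i in F. \<forall>x\<in>S. f i differentiable (at x)" by auto
  hence "\<forall>\<^sub>F i in F. \<forall>j\<le>0. \<forall>x\<in>S.
         (deriv ^^ j) (f i) differentiable (at x) \<and> \<bar>(deriv ^^ j) (f i) x\<bar> \<le> C"
    by eventually_elim auto
  thus ?case by blast
next
  case (Suc m)
  from Suc.prems obtain C0 where C0: "\<forall>\<^sub>F i in F. \<forall>x\<in>S. \<bar>f i x\<bar> \<le> C0"
    "\<forall>\<^sub>F i in F. \<forall>x\<in>S. f i differentiable (at x)" by auto
  from Suc.IH[of "\<lambda>i. deriv (f i)"] Suc.prems obtain C1 where
    C1: "\<forall>\<^sub>F i in F. \<forall>j\<le>m. \<forall>x\<in>S. (deriv ^^ j) (deriv (f i)) differentiable (at x) \<and>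
           \<bar>(deriv ^^ j) (deriv (f i)) x\<bar> \<le> C1" by auto
  from C0 C1 have "\<forall>\<^sub>F i in F. \<forall>j\<le>Suc m. \<forall>x\<in>S.
         (deriv ^^ j) (f i) differentiable (at x) \<and> \<bar>(deriv ^^ j) (f i) x\<bar> \<le> max C0 C1"
  proof eventually_elim
    case (elim i)
    show ?case
    proof (intro allI impI ballI)
      fix j x assume "j \<le> Suc m" "x \<in> S"
      thus "(deriv ^^ j) (f i) differentiable (at x) \<and> \<bar>(deriv ^^ j) (f i) x\<bar> \<le> max C0 C1"
        using elim by (cases j) (auto simp: funpow_Suc_right le_max_iff_disj simp del: funpow.simps(2))
    qed
  qed
  thus ?case by blast
qed

section \<open>Damped linear equations and interior regularity\<close>

text \<open>
  The bootstrap step for regularity: an equation that expresses \<open>V\<close> by differentiable terms makes \<open>V\<close>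
  itself differentiable, and may then be differentiated.
\<close>

lemma differentiable_from_equation:
  fixes V h :: "real \<Rightarrow> real"
  assumes "n > 0" "open S" "S \<subseteq> {-1<..<1}" and x: "x \<in> S"
    and eq: "\<And>y. y \<in> S \<Longrightarrow> n * (1 - y\<^sup>2) * V y + h y = 0"
    and h: "h differentiable (at x)"
  shows "V differentiable (at x)"
    and "n * (1 - x\<^sup>2) * deriv V x - 2 * n * x * V x + deriv h x = 0"
proof -
  have V: "- h y / (n * (1 - y\<^sup>2)) = V y" if "y \<in> S" for y
    using eq[OF that] one_minus_sq_pos[of y] that assms(1,3) by (auto simp: field_simps)
  have nz: "n * (1 - x\<^sup>2) \<noteq> 0" using one_minus_sq_pos[of x] x assms(1,3) by auto
  hence "(\<lambda>y. - h y / (n * (1 - y\<^sup>2))) differentiable (at x)"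
    using h by (intro derivative_intros) auto
  thus d: "V differentiable (at x)"
    using differentiable_eq_on_open[where g = V, OF assms(2) x V] by blast
  have "((\<lambda>y. n * (1 - y\<^sup>2) * V y + h y) has_real_derivative
      n * (1 - x\<^sup>2) * deriv V x - 2 * n * x * V x + deriv h x) (at x)"
    by (auto intro!: derivative_eq_intros has_real_derivative_deriv d h simp: algebra_simps)
  hence "((\<lambda>y. 0) has_real_derivative
      n * (1 - x\<^sup>2) * deriv V x - 2 * n * x * V x + deriv h x) (at x)"
    by (rule has_field_derivative_transform_within_open[OF _ assms(2) x]) (use eq in auto)
  thus "n * (1 - x\<^sup>2) * deriv V x - 2 * n * x * V x + deriv h x = 0"
    using DERIV_unique[OF _ DERIV_const] by blast
qed

text \<open>
  Since \<open>V\<close> is the derivative of a bounded function, the mean value theorem gives a point \<open>z\<close> between \<open>a\<close>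
  and \<open>a'\<close> where \<open>V\<close> is bounded without any loss in \<open>n\<close>. To the right of \<open>z\<close> the damping \<open>A \<ge> \<delta>\<close> makes
  \<open>\<bar>V\<bar>\<close> decrease whenever it exceeds \<open>C / \<delta>\<close>. The resulting bound is the same for all \<open>n\<close>.
\<close>

lemma damped_bound:
  fixes V A f g :: "real \<Rightarrow> real"
  assumes "n > 0" "-1 \<le> a" "a < a'" "b \<le> 1" "\<delta> > 0"
    and eq: "\<And>x. x \<in> {a<..<b} \<Longrightarrow> n * (1 - x\<^sup>2) * deriv V x + A x * V x = f x"
    and V: "\<And>x. x \<in> {a<..<b} \<Longrightarrow> V differentiable (at x)"
    and g: "\<And>x. x \<in> {a<..<b} \<Longrightarrow> (g has_real_derivative V x) (at x)"
    and A: "\<And>x. x \<in> {a<..<b} \<Longrightarrow> A x \<ge> \<delta>"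
    and f: "\<And>x. x \<in> {a<..<b} \<Longrightarrow> \<bar>f x\<bar> \<le> C"
    and G: "\<And>x. x \<in> {a<..<b} \<Longrightarrow> \<bar>g x\<bar> \<le> G"
    and x: "x \<in> {a'<..<b}"
  shows "\<bar>V x\<bar> \<le> max (6 * G / (a' - a)) (C / \<delta>)"
proof -
  define K where "K = max (6 * G / (a' - a)) (C / \<delta>)"
  define l where "l = (a' - a) / 3"
  have l: "l > 0" "a + 3 * l = a'" using assms(3) by (auto simp: l_def field_simps)
  have "a + l < a + 2 * l" using l by simp
  then obtain z where z: "a + l < z" "z < a + 2 * l"
    "g (a + 2 * l) - g (a + l) = (a + 2 * l - (a + l)) * V z"
    using MVT2[of "a + l" "a + 2 * l" g V] g x l by force
  have ends: "a + l \<in> {a<..<b}" "a + 2 * l \<in> {a<..<b}" using l x by auto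
  have "l * \<bar>V z\<bar> = \<bar>g (a + 2 * l) - g (a + l)\<bar>"
    using z(3) l(1) by (simp add: abs_mult)
  also have "\<dots> \<le> 2 * G" using G[OF ends(1)] G[OF ends(2)] by linarith
  finally have "\<bar>V z\<bar> \<le> 2 * G / l" using l(1) by (simp add: field_simps)
  also have "2 * G / l = 6 * G / (a' - a)" by (simp add: l_def)
  finally have Vz: "\<bar>V z\<bar> \<le> K" by (simp add: K_def)
  hence K0: "K \<ge> 0" by linarith
  have CK: "C \<le> \<delta> * K"
  proof -
    have "C / \<delta> \<le> K" by (simp add: K_def)
    thus ?thesis using assms(5) by (simp add: field_simps)
  qed
  have zx: "z \<le> x" using z l x by auto
  have sub: "t \<in> {a<..<b}" if "z \<le> t" "t \<le> x" for t using that z l x by auto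
  have pos: "n * (1 - t\<^sup>2) > 0" if "t \<in> {a<..<b}" for t
    using one_minus_sq_pos[of t] that assms(1,2,4) by auto
  have "V x \<le> K"
  proof (rule stays_below_level[OF zx, where y' = "deriv V"])
    fix t assume t: "z \<le> t" "t \<le> x"
    show "(V has_real_derivative deriv V t) (at t)"
      using V[OF sub[OF t]] by (rule has_real_derivative_deriv)
    assume "V t > K"
    hence "\<delta> * K \<le> A t * V t" using A[OF sub[OF t]] assms(5) K0 by (intro mult_mono) auto
    hence "n * (1 - t\<^sup>2) * deriv V t \<le> 0"
      using eq[OF sub[OF t]] f[OF sub[OF t]] CK by linarith
    thus "deriv V t \<le> 0" using mult_pos_pos[OF pos[OF sub[OF t]]] by (meson not_le)
  qed (use Vz in auto)
  moreover have "- V x \<le> K"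
  proof (rule stays_below_level[OF zx, where y' = "\<lambda>t. - deriv V t"])
    fix t assume t: "z \<le> t" "t \<le> x"
    show "((\<lambda>t. - V t) has_real_derivative - deriv V t) (at t)"
      using V[OF sub[OF t]] by (intro DERIV_minus has_real_derivative_deriv)
    assume "- V t > K"
    hence "\<delta> * K \<le> A t * (- V t)" using A[OF sub[OF t]] assms(5) K0 by (intro mult_mono) auto
    hence "n * (1 - t\<^sup>2) * deriv V t \<ge> 0"
      using eq[OF sub[OF t]] f[OF sub[OF t]] CK by (simp add: abs_le_iff)
    hence "deriv V t \<ge> 0" using mult_pos_neg[OF pos[OF sub[OF t]]] by (meson not_less)
    thus "- deriv V t \<le> 0" by simp
  qed (use Vz in auto)
  ultimately show ?thesis by (simp add: K_def abs_le_iff)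
qed

text \<open>
  By induction on the order: the derivative of \<open>V\<close> solves the equation of the same form with damping
  \<open>A - 2 n x\<close>, which is at least \<open>\<delta> / 2\<close> once \<open>n\<close> is small, with right-hand side \<open>f' - A' V\<close>, and it is the
  derivative of the bounded function \<open>V\<close>. Each order loses a bit of the interval on the left, where
  the mean value theorem has to find a starting point.
\<close>

lemma damped_bdd_derivs:
  fixes n :: "'i \<Rightarrow> real"
  assumes n: "\<forall>\<^sub>F i in F. n i > 0" "(n \<longlongrightarrow> 0) F" and b: "b \<le> 1"
  shows "-1 \<le> a \<Longrightarrow> a < a' \<Longrightarrow> a' < b \<Longrightarrow> \<delta> > 0 \<Longrightarrow>
    bdd_derivs m F {a<..<b} A \<Longrightarrow> bdd_derivs m F {a<..<b} f \<Longrightarrow> bdd_derivs 0 F {a<..<b} g \<Longrightarrow>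
    (\<forall>\<^sub>F i in F. \<forall>x\<in>{a<..<b}. (g i has_real_derivative V i x) (at x) \<and> V i differentiable (at x) \<and>
       n i * (1 - x\<^sup>2) * deriv (V i) x + A i x * V i x = f i x \<and> A i x \<ge> \<delta>) \<Longrightarrow>
    bdd_derivs m F {a'<..<b} V"
proof (induction m arbitrary: a a' \<delta> A f g V)
  case (0 a a' \<delta> A f g V)
  obtain C G where "\<forall>\<^sub>F i in F. \<forall>x\<in>{a<..<b}. \<bar>f i x\<bar> \<le> C" "\<forall>\<^sub>F i in F. \<forall>x\<in>{a<..<b}. \<bar>g i x\<bar> \<le> G"
    using 0(6,7) by auto
  with n(1) 0(8) have "\<forall>\<^sub>F i in F. \<forall>x\<in>{a'<..<b}. \<bar>V i x\<bar> \<le> max (6 * G / (a' - a)) (C / \<delta>)"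
  proof eventually_elim
    case (elim i)
    show ?case
    proof
      fix x assume "x \<in> {a'<..<b}"
      with elim show "\<bar>V i x\<bar> \<le> max (6 * G / (a' - a)) (C / \<delta>)"
        by (intro damped_bound[of "n i" a a' b \<delta> "V i" "A i" "f i" "g i"] 0 b) blast+
    qed
  qed
  thus ?case by auto
next
  case (Suc m a a' \<delta> A f g V)
  define a1 where "a1 = (a + a') / 2"
  have a1: "-1 \<le> a1" "a < a1" "a1 < a'" "a1 < b" using Suc.prems by (auto simp: a1_def)
  have sub: "{a1<..<b} \<subseteq> {a<..<b}" using a1 by auto
  have V: "bdd_derivs m F {a1<..<b} V"
    using Suc.prems(1,4,7,8) a1 bdd_derivs_SucD[OF Suc.prems(5)] bdd_derivs_SucD[OF Suc.prems(6)]
    by (intro Suc.IH[of a a1 \<delta> A f g]) auto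
  have small: "\<forall>\<^sub>F i in F. n i < \<delta> / 4" "\<forall>\<^sub>F i in F. n i < 1"
    using order_tendstoD(2)[OF n(2), of "\<delta> / 4"] order_tendstoD(2)[OF n(2), of 1] Suc.prems(4)
    by auto
  have dAf: "\<forall>\<^sub>F i in F. \<forall>x\<in>{a<..<b}. A i differentiable (at x)"
    "\<forall>\<^sub>F i in F. \<forall>x\<in>{a<..<b}. f i differentiable (at x)"
    using Suc.prems by auto
  have "\<forall>\<^sub>F i in F. \<forall>x\<in>{a1<..<b}. (V i has_real_derivative deriv (V i) x) (at x) \<and>
       deriv (V i) differentiable (at x) \<and>
       n i * (1 - x\<^sup>2) * deriv (deriv (V i)) x + (A i x - 2 * n i * x) * deriv (V i) x
         = deriv (f i) x - deriv (A i) x * V i x \<and> A i x - 2 * n i * x \<ge> \<delta> / 2"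
    using n(1) small(1) dAf Suc.prems(8)
  proof eventually_elim
    case (elim i)
    show ?case
    proof
      fix x assume x: "x \<in> {a1<..<b}"
      hence x': "x \<in> {a<..<b}" using sub by blast
      have dV: "V i differentiable (at x)" and dA: "A i differentiable (at x)"
        and df: "f i differentiable (at x)" and Ax: "A i x \<ge> \<delta>"
        using elim x' by auto
      have h: "(\<lambda>x. A i x * V i x - f i x) differentiable (at x)"
        using dV dA df by auto
      have eq: "n i * (1 - y\<^sup>2) * deriv (V i) y + (A i y * V i y - f i y) = 0" if "y \<in> {a<..<b}" for y
        using elim(5) that by (simp add: algebra_simps)
      note D = differentiable_from_equation[OF elim(1) open_greaterThanLessThan _ x' eq h]
      have S: "{a<..<b} \<subseteq> {-1<..<1}" using Suc.prems(1) b by auto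
      have "deriv (\<lambda>x. A i x * V i x - f i x) x
          = deriv (A i) x * V i x + deriv (V i) x * A i x - deriv (f i) x"
        by (intro DERIV_imp_deriv DERIV_diff DERIV_mult has_real_derivative_deriv dV dA df)
      hence "n i * (1 - x\<^sup>2) * deriv (deriv (V i)) x + (A i x - 2 * n i * x) * deriv (V i) x
         = deriv (f i) x - deriv (A i) x * V i x"
        using D(2)[OF S] by (simp add: algebra_simps)
      moreover have "n i * x \<le> n i * 1"
        using elim(1) x' b by (intro mult_left_mono) auto
      hence "A i x - 2 * n i * x \<ge> \<delta> / 2" using Ax elim(2) by simp
      ultimately show "(V i has_real_derivative deriv (V i) x) (at x) \<and>
         deriv (V i) differentiable (at x) \<and>
         n i * (1 - x\<^sup>2) * deriv (deriv (V i)) x + (A i x - 2 * n i * x) * deriv (V i) x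
           = deriv (f i) x - deriv (A i) x * V i x \<and> A i x - 2 * n i * x \<ge> \<delta> / 2"
        using D(1)[OF S] has_real_derivative_deriv[OF dV] by blast
    qed
  qed
  moreover have "bdd_derivs m F {a1<..<b} (\<lambda>i x. A i x - 2 * n i * x)"
  proof (intro bdd_derivs_diff bdd_derivs_mult[where f = "\<lambda>i x. 2 * n i"])
    have "\<forall>\<^sub>F i in F. \<bar>2 * n i\<bar> \<le> 2" using n(1) small(2) by eventually_elim auto
    thus "bdd_derivs m F {a1<..<b} (\<lambda>i x. 2 * n i)" by (rule bdd_derivs_const)
    show "bdd_derivs m F {a1<..<b} (\<lambda>i x. x)"
      using a1 b by (intro bdd_derivs_ident) auto
  qed (use bdd_derivs_subset[OF sub] bdd_derivs_SucD[OF Suc.prems(5)] in auto)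
  moreover have "bdd_derivs m F {a1<..<b} (\<lambda>i x. deriv (f i) x - deriv (A i) x * V i x)"
    using V bdd_derivs_subset[OF sub] Suc.prems(5,6)
    by (intro bdd_derivs_diff bdd_derivs_mult) auto
  moreover have "bdd_derivs 0 F {a1<..<b} V"
    using bdd_derivs_imp_bdd[OF V] by simp
  ultimately have "bdd_derivs m F {a'<..<b} (\<lambda>i. deriv (V i))"
    using Suc.prems(3,4) a1
    by (intro Suc.IH[of a1 a' "\<delta> / 2" "\<lambda>i x. A i x - 2 * n i * x"
          "\<lambda>i x. deriv (f i) x - deriv (A i) x * V i x" V]) auto
  moreover have "bdd_derivs m F {a'<..<b} V"
    by (rule bdd_derivs_subset[OF _ V]) (use a1 in auto)
  moreover have "\<forall>\<^sub>F i in F. \<forall>x\<in>{a'<..<b}. V i differentiable (at x)"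
    using Suc.prems(8) by eventually_elim (use Suc.prems(2) in auto)
  ultimately show ?case using bdd_derivs_imp_bdd by auto
qed

text \<open>
  The derivative of \<open>U\<close> solves the damped equation \<open>n (1 - x\<^sup>2) V' + U V = q' - 2 n U\<close>, so bounds on the
  derivatives of \<open>U\<close> up to order \<open>m\<close> yield one on the next derivative. The original equation, read as
  \<open>(U - sqrt (2 q)) (U + sqrt (2 q)) = -2 n ((1 - x\<^sup>2) U' + 2 x U)\<close>, then exhibits \<open>(U - sqrt (2 q)) / n\<close>
  as a quotient of families with bounded derivatives.
\<close>

lemma interior_bdd_derivs:
  fixes n :: "'i \<Rightarrow> real" and U q :: "'i \<Rightarrow> real \<Rightarrow> real"
  assumes n: "\<forall>\<^sub>F i in F. n i > 0" "(n \<longlongrightarrow> 0) F"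
    and q: "\<And>m. bdd_derivs m F {-1<..<1} q"
    and U: "\<forall>\<^sub>F i in F. \<forall>x\<in>{-1<..<1}. U i differentiable (at x) \<and>
        n i * (1 - x\<^sup>2) * deriv (U i) x + 2 * n i * x * U i x + (U i x)\<^sup>2 / 2 = q i x"
    and U_bdd: "bdd_derivs 0 F {-1<..<1} U"
    and pos: "\<And>a b. -1 < a \<Longrightarrow> b < 1 \<Longrightarrow> \<exists>\<delta>>0. \<forall>\<^sub>F i in F. \<forall>x\<in>{a<..<b}. U i x \<ge> \<delta> \<and> q i x \<ge> \<delta>"
    and ab: "-1 < a" "a < b" "b < 1"
  shows "bdd_derivs m F {a<..<b} (\<lambda>i x. (U i x - sqrt (2 * q i x)) / n i)"
proof -
  have "\<forall>\<^sub>F i in F. n i < 1" using order_tendstoD(2)[OF n(2)] by auto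
  hence n2: "\<forall>\<^sub>F i in F. \<bar>2 * n i\<bar> \<le> 2" using n(1) by eventually_elim auto
  have id: "bdd_derivs m F {a<..<b} (\<lambda>i x. x)" if "-1 < a" "b < 1" for m a b
    using that by (intro bdd_derivs_ident) auto
  have smooth: "bdd_derivs m F {a<..<b} U" if "-1 < a" "a < b" "b < 1" for m a b
    using that
  proof (induction m arbitrary: a b)
    case 0
    hence "{a<..<b} \<subseteq> {-1<..<1}" by auto
    thus ?case using bdd_derivs_subset[OF _ U_bdd] by blast
  next
    case (Suc m a b)
    define a0 where "a0 = (a - 1) / 2"
    have a0: "-1 < a0" "a0 < a" "a0 < b" using Suc.prems by (auto simp: a0_def)
    have sub: "{a0<..<b} \<subseteq> {-1<..<1}" using a0 Suc.prems by auto
    have IH: "bdd_derivs m F {a0<..<b} U" using Suc.IH[of a0 b] a0 Suc.prems by auto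
    obtain \<delta> where \<delta>: "\<delta> > 0" "\<forall>\<^sub>F i in F. \<forall>x\<in>{a0<..<b}. U i x \<ge> \<delta> \<and> q i x \<ge> \<delta>"
      using pos[OF a0(1) Suc.prems(3)] by blast
    have dq: "\<forall>\<^sub>F i in F. \<forall>x\<in>{-1<..<1}. q i differentiable (at x)" using q[of 1] by simp
    have "\<forall>\<^sub>F i in F. \<forall>x\<in>{a0<..<b}. (U i has_real_derivative deriv (U i) x) (at x) \<and>
       deriv (U i) differentiable (at x) \<and>
       n i * (1 - x\<^sup>2) * deriv (deriv (U i)) x + U i x * deriv (U i) x
         = deriv (q i) x - 2 * n i * U i x \<and> U i x \<ge> \<delta>"
      using n(1) dq U \<delta>(2)
    proof eventually_elim
      case (elim i)
      show ?case
      proof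
        fix x assume x: "x \<in> {a0<..<b}"
        hence x': "x \<in> {-1<..<1}" using sub by blast
        have dU: "U i differentiable (at x)" and dq: "q i differentiable (at x)"
          and Ux: "U i x \<ge> \<delta>" using elim x x' by auto
        have h': "((\<lambda>x. 2 * n i * x * U i x + (U i x)\<^sup>2 / 2 - q i x) has_real_derivative
           2 * n i * U i x + 2 * n i * x * deriv (U i) x + U i x * deriv (U i) x - deriv (q i) x) (at x)"
          by (auto intro!: derivative_eq_intros has_real_derivative_deriv dU dq)
        hence h: "(\<lambda>x. 2 * n i * x * U i x + (U i x)\<^sup>2 / 2 - q i x) differentiable (at x)"
          by (auto simp: real_differentiable_def)
        have eq: "n i * (1 - y\<^sup>2) * deriv (U i) y + (2 * n i * y * U i y + (U i y)\<^sup>2 / 2 - q i y) = 0"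
          if "y \<in> {-1<..<1}" for y
          using elim(3) that by (simp add: algebra_simps)
        note D = differentiable_from_equation[OF elim(1) open_greaterThanLessThan order_refl x' eq h]
        have "n i * (1 - x\<^sup>2) * deriv (deriv (U i)) x + U i x * deriv (U i) x
         = deriv (q i) x - 2 * n i * U i x"
          using D(2) DERIV_imp_deriv[OF h'] by (simp add: algebra_simps)
        thus "(U i has_real_derivative deriv (U i) x) (at x) \<and>
           deriv (U i) differentiable (at x) \<and>
           n i * (1 - x\<^sup>2) * deriv (deriv (U i)) x + U i x * deriv (U i) x
             = deriv (q i) x - 2 * n i * U i x \<and> U i x \<ge> \<delta>"
          using D(1) has_real_derivative_deriv[OF dU] Ux by blast
      qed
    qed
    moreover have "bdd_derivs m F {a0<..<b} (\<lambda>i x. deriv (q i) x - 2 * n i * U i x)"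
    proof (intro bdd_derivs_diff bdd_derivs_mult[where f = "\<lambda>i x. 2 * n i"])
      show "bdd_derivs m F {a0<..<b} (\<lambda>i x. 2 * n i)" using n2 by (rule bdd_derivs_const)
      show "bdd_derivs m F {a0<..<b} (\<lambda>i. deriv (q i))"
        using bdd_derivs_subset[OF sub q[of "Suc m"]] by simp
    qed (use IH in auto)
    moreover have "bdd_derivs 0 F {a0<..<b} U"
      using bdd_derivs_imp_bdd[OF IH] by simp
    ultimately have "bdd_derivs m F {a<..<b} (\<lambda>i. deriv (U i))"
      using a0 \<delta>(1) IH Suc.prems
      by (intro damped_bdd_derivs[OF n, of b a0 a \<delta> m U
            "\<lambda>i x. deriv (q i) x - 2 * n i * U i x" U]) auto
    moreover have "\<exists>C. \<forall>\<^sub>F i in F. \<forall>x\<in>{a<..<b}. \<bar>U i x\<bar> \<le> C"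
      using Suc.IH[OF Suc.prems] by (rule bdd_derivs_imp_bdd)
    moreover have "\<forall>\<^sub>F i in F. \<forall>x\<in>{a<..<b}. U i differentiable (at x)"
      using U by eventually_elim (use Suc.prems in auto)
    ultimately show ?case by simp
  qed
  have sub: "{a<..<b} \<subseteq> {-1<..<1}" using ab by auto
  obtain \<delta> where \<delta>: "\<delta> > 0" "\<forall>\<^sub>F i in F. \<forall>x\<in>{a<..<b}. U i x \<ge> \<delta> \<and> q i x \<ge> \<delta>"
    using pos[OF ab(1,3)] by blast
  have Uq: "\<forall>\<^sub>F i in F. \<forall>x\<in>{a<..<b}. U i x + sqrt (2 * q i x) \<ge> \<delta>"
    using \<delta>(2)
  proof eventually_elim
    case (elim i)
    show ?case
    proof
      fix x assume x: "x \<in> {a<..<b}"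
      hence "U i x \<ge> \<delta>" "q i x \<ge> \<delta>" using elim by blast+
      moreover from this have "0 \<le> sqrt (2 * q i x)" using \<delta>(1) by simp
      ultimately show "U i x + sqrt (2 * q i x) \<ge> \<delta>" by linarith
    qed
  qed
  have "\<forall>\<^sub>F i in F. \<forall>x\<in>{a<..<b}. 2 * q i x \<ge> 2 * \<delta>"
    using \<delta>(2) by eventually_elim auto
  hence "bdd_derivs m F {a<..<b} (\<lambda>i x. sqrt (2 * q i x))"
    using \<delta>(1) bdd_derivs_subset[OF sub q]
    by (intro bdd_derivs_sqrt[of _ "2 * \<delta>"] bdd_derivs_mult bdd_derivs_const[where C = 2]) auto
  hence "bdd_derivs m F {a<..<b} (\<lambda>i x. U i x + sqrt (2 * q i x))"
    using smooth[OF ab] by (intro bdd_derivs_add) auto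
  hence "bdd_derivs m F {a<..<b} (\<lambda>i x. inverse (U i x + sqrt (2 * q i x)))"
    using Uq \<delta>(1) by (intro bdd_derivs_inverse) auto
  moreover have "bdd_derivs m F {a<..<b} (\<lambda>i. deriv (U i))"
    using smooth[OF ab, of "Suc m"] by simp
  ultimately have "bdd_derivs m F {a<..<b} (\<lambda>i x.
      (-2) * (((1 - x * x) * deriv (U i) x + 2 * (x * U i x)) * inverse (U i x + sqrt (2 * q i x))))"
    using smooth[OF ab] id[OF ab(1,3)]
    by (intro bdd_derivs_mult bdd_derivs_add bdd_derivs_diff bdd_derivs_const[where C = 2]) auto
  thus ?thesis
  proof (rule bdd_derivs_cong[rotated])
    show "\<forall>\<^sub>F i in F. \<forall>x\<in>{a<..<b}.
      (-2) * (((1 - x * x) * deriv (U i) x + 2 * (x * U i x)) * inverse (U i x + sqrt (2 * q i x)))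
      = (U i x - sqrt (2 * q i x)) / n i"
      using n(1) U \<delta>(2) Uq
    proof eventually_elim
      case (elim i)
      show ?case
      proof
        fix x assume x: "x \<in> {a<..<b}"
        define Q where "Q = sqrt (2 * q i x)"
        have q0: "q i x \<ge> \<delta>" and UQ: "U i x + sqrt (2 * q i x) \<ge> \<delta>"
          using elim(3,4) x by blast+
        have Q2: "Q * Q = 2 * q i x" using q0 \<delta>(1) by (simp add: Q_def)
        have nz: "U i x + Q \<noteq> 0" using UQ \<delta>(1) by (simp add: Q_def)
        have "n i * (1 - x\<^sup>2) * deriv (U i) x + 2 * n i * x * U i x + (U i x)\<^sup>2 / 2 = q i x"
          using elim(2) x sub by blast
        hence "(-2) * n i * ((1 - x * x) * deriv (U i) x + 2 * (x * U i x)) = (U i x - Q) * (U i x + Q)"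
          using Q2 by (simp add: power2_eq_square algebra_simps)
        hence "(-2) * ((1 - x * x) * deriv (U i) x + 2 * (x * U i x)) / (U i x + Q) = (U i x - Q) / n i"
          using nz elim(1) by (simp add: field_simps)
        thus "(-2) * (((1 - x * x) * deriv (U i) x + 2 * (x * U i x)) * inverse (U i x + sqrt (2 * q i x)))
          = (U i x - sqrt (2 * q i x)) / n i"
          unfolding Q_def divide_inverse by (simp only: mult.assoc)
      qed
    qed
  qed auto
qed

lemma funpow_deriv_affine:
  fixes f :: "real \<Rightarrow> real" and s a :: real
  assumes "open S" "open S'" "\<And>x. x \<in> S' \<Longrightarrow> s * x \<in> S"
    and "\<And>j x. j < m \<Longrightarrow> x \<in> S \<Longrightarrow> (deriv ^^ j) f differentiable (at x)"
    and "j \<le> m" "x \<in> S'"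
  shows "(deriv ^^ j) (\<lambda>x. a * f (s * x)) x = a * s ^ j * (deriv ^^ j) f (s * x)"
  using assms(5,6)
proof (induction j arbitrary: x)
  case 0
  thus ?case by simp
next
  case (Suc j)
  have "(deriv ^^ Suc j) (\<lambda>x. a * f (s * x)) x = deriv (\<lambda>x. a * s ^ j * (deriv ^^ j) f (s * x)) x"
    using Suc by (auto intro!: deriv_eq_on_open[OF assms(2)])
  also have "\<dots> = a * s ^ Suc j * (deriv ^^ Suc j) f (s * x)"
  proof (rule DERIV_imp_deriv)
    have "((deriv ^^ j) f has_real_derivative (deriv ^^ Suc j) f (s * x)) (at (s * x))"
      using has_real_derivative_deriv[OF assms(4)[of j "s * x"]] assms(3)[of x] Suc.prems by auto
    moreover have "((\<lambda>x. s * x) has_real_derivative s) (at x)"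
      by (auto intro!: derivative_eq_intros)
    ultimately have "((\<lambda>x. (deriv ^^ j) f (s * x)) has_real_derivative (deriv ^^ Suc j) f (s * x) * s) (at x)"
      by (rule DERIV_chain2)
    from DERIV_cmult[OF this, of "a * s ^ j"]
    show "((\<lambda>x. a * s ^ j * (deriv ^^ j) f (s * x)) has_real_derivative
        a * s ^ Suc j * (deriv ^^ Suc j) f (s * x)) (at x)"
      by (simp add: mult_ac)
  qed
  finally show ?case .
qed

section \<open>Reflection\<close>

text \<open>
  The reflection \<open>x \<mapsto> - x\<close>, \<open>U \<mapsto> - U\<close> preserves the differential equation, exchanges \<open>c\<^sub>1\<close> and \<open>c\<^sub>2\<close>, and
  reverses the order of solutions.
\<close>

definition swap_ends :: "real ^ 3 \<Rightarrow> real ^ 3" where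
  "swap_ends c = (\<chi> i. if i = 1 then c $ 2 else if i = 2 then c $ 1 else c $ 3)"

lemma swap_ends_nth [simp]:
  "swap_ends c $ 1 = c $ 2" "swap_ends c $ 2 = c $ 1" "swap_ends c $ 3 = c $ 3"
  by (auto simp: swap_ends_def)

lemma swap_ends_swap_ends [simp]: "swap_ends (swap_ends c) = c"
  by (simp add: vec_eq_iff forall_3)

lemma P_swap_ends: "P (swap_ends c) x = P c (- x)"
  by (simp add: P_def)

lemma riccati_reflect:
  assumes "riccati \<nu> p Y"
  shows "riccati \<nu> (\<lambda>x. p (- x)) (\<lambda>x. - Y (- x))"
  unfolding riccati_def
proof
  fix x :: real assume "x \<in> {-1<..<1}"
  hence "- x \<in> {-1<..<1}" by auto
  from assms[unfolded riccati_def, rule_format, OF this]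
  have "(Y has_real_derivative (p (- x) - (Y (- x))\<^sup>2 / 2) / (\<nu> * (1 - x\<^sup>2))) (at (- x))"
    by simp
  moreover have "((\<lambda>x. - x) has_real_derivative -1) (at x)"
    by (auto intro!: derivative_eq_intros)
  ultimately have "((\<lambda>x. Y (- x)) has_real_derivative
      (p (- x) - (Y (- x))\<^sup>2 / 2) / (\<nu> * (1 - x\<^sup>2)) * (-1)) (at x)"
    by (rule DERIV_chain2)
  from DERIV_minus[OF this]
  show "((\<lambda>x. - Y (- x)) has_real_derivative (p (- x) - (- Y (- x))\<^sup>2 / 2) / (\<nu> * (1 - x\<^sup>2))) (at x)"
    by simp
qed

lemma is_solution_reflect:
  assumes "\<nu> > 0" "is_solution \<nu> c U"
  shows "is_solution \<nu> (swap_ends c) (\<lambda>x. - U (- x))"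
proof -
  have "riccati \<nu> (\<lambda>x. P c x + 2 * \<nu>\<^sup>2) (\<lambda>x. U x + 2 * \<nu> * x)"
    using assms is_solution_iff_riccati by blast
  from riccati_reflect[OF this] show ?thesis
    using assms(1) by (simp add: is_solution_iff_riccati P_swap_ends)
qed

lemma lower_reflect_is_upper:
  assumes "\<nu> > 0" "is_lower_solution \<nu> c U"
  shows "is_upper_solution \<nu> (swap_ends c) (\<lambda>x. - U (- x))"
  unfolding is_upper_solution_def
proof (intro conjI allI impI ballI)
  show "is_solution \<nu> (swap_ends c) (\<lambda>x. - U (- x))"
    using assms by (auto simp: is_lower_solution_def intro: is_solution_reflect)
  fix V x assume "is_solution \<nu> (swap_ends c) V" and x: "x \<in> {-1<..<1::real}"
  from is_solution_reflect[OF assms(1) this(1)] have "is_solution \<nu> c (\<lambda>x. - V (- x))" by simp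
  moreover have "- x \<in> {-1<..<1}" using x by auto
  ultimately have "U (- x) \<le> - V (- (- x))"
    using assms(2) unfolding is_lower_solution_def by blast
  thus "V x \<le> - U (- x)" by simp
qed

section \<open>Uniform estimates for upper solutions\<close>

text \<open>
  All estimates are proved for this class of triples \<open>(\<nu>, c, U)\<close> with constants that depend on \<open>\<kappa>\<close> and \<open>M\<close>
  only; this is what makes them independent of the sequence. The lower bound allows \<open>P c + 2 \<nu>\<^sup>2\<close> to
  vanish linearly at either end.
\<close>

definition admissible :: "real \<Rightarrow> real \<Rightarrow> real \<Rightarrow> real ^ 3 \<Rightarrow> (real \<Rightarrow> real) \<Rightarrow> bool" where
  "admissible \<kappa> M \<nu> c U \<longleftrightarrow>
     0 < \<nu> \<and> (\<forall>i. \<bar>c $ i\<bar> \<le> M) \<and> (\<forall>x\<in>{-1<..<1}. \<kappa> * (1 - x\<^sup>2) \<le> P c x + 2 * \<nu>\<^sup>2) \<and>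
     is_upper_solution \<nu> c U"

lemma upper_imp_maximal_riccati:
  assumes "\<nu> > 0" "is_upper_solution \<nu> c U"
  shows "maximal_riccati \<nu> (\<lambda>x. P c x + 2 * \<nu>\<^sup>2) (\<lambda>x. U x + 2 * \<nu> * x)"
  unfolding maximal_riccati_def
proof (intro conjI allI impI ballI)
  show "riccati \<nu> (\<lambda>x. P c x + 2 * \<nu>\<^sup>2) (\<lambda>x. U x + 2 * \<nu> * x)"
    using assms by (simp add: is_upper_solution_def is_solution_iff_riccati)
  fix V x assume "riccati \<nu> (\<lambda>x. P c x + 2 * \<nu>\<^sup>2) V" and x: "x \<in> {-1<..<1::real}"
  hence "is_solution \<nu> c (\<lambda>x. V x - 2 * \<nu> * x)"
    by (simp add: is_solution_iff_riccati[OF assms(1)])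
  hence "V x - 2 * \<nu> * x \<le> U x" using assms(2) x by (auto simp: is_upper_solution_def)
  thus "V x \<le> U x + 2 * \<nu> * x" by simp
qed

lemma abs_P_le:
  assumes "\<And>i. \<bar>c $ i\<bar> \<le> M" "x \<in> {-1<..<1}"
  shows "\<bar>P c x\<bar> \<le> 5 * M"
proof -
  have "\<bar>c $ 1 * (1 - x)\<bar> \<le> M * 2" "\<bar>c $ 2 * (1 + x)\<bar> \<le> M * 2"
    using assms by (auto simp: abs_mult intro!: mult_mono intro: order_trans[OF abs_ge_zero])
  moreover have "\<bar>c $ 3 * (1 - x\<^sup>2)\<bar> \<le> M * 1"
    using assms one_minus_sq_pos[OF assms(2)] unfolding abs_mult
    by (intro mult_mono) (auto intro: order_trans[OF abs_ge_zero])
  ultimately show ?thesis unfolding P_def by linarith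
qed

text \<open>
  For \<open>Y = U + 2 \<nu> x\<close> the barriers give \<open>\<bar>Y - R\<bar> \<le> B \<nu>\<close> with \<open>R\<^sup>2 = 2 P c + (4 + B\<^sup>2) \<nu>\<^sup>2\<close>; as \<open>Y + R\<close> is
  bounded, \<open>Y\<^sup>2\<close> differs from \<open>2 P c\<close> by \<open>O(\<nu>)\<close>, uniformly up to the endpoints.
\<close>

lemma upper_shift_bounds:
  assumes "\<kappa> > 0" "M > 0"
  obtains C where "C > 0"
    "\<And>\<nu> c U x. admissible \<kappa> M \<nu> c U \<Longrightarrow> \<nu> < 1 \<Longrightarrow> x \<in> {-1<..<1} \<Longrightarrow>
       0 \<le> U x + 2 * \<nu> * x \<and> U x + 2 * \<nu> * x \<le> C \<and>
       \<bar>(U x + 2 * \<nu> * x)\<^sup>2 - 2 * P c x\<bar> \<le> C * \<nu>"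
proof -
  define B where "B = 4 * M / \<kappa>"
  define L where "L = sqrt (10 * M + 4 + B\<^sup>2)"
  define C where "C = (L + B) + (B * (2 * L + B) + 4 + B\<^sup>2)"
  have B: "B > 0" using assms by (simp add: B_def)
  have L: "L > 0" using assms by (simp add: L_def add_pos_nonneg)
  have C: "C > 0" using B L by (auto simp: C_def intro!: add_pos_pos mult_pos_pos)
  have "0 \<le> U x + 2 * \<nu> * x \<and> U x + 2 * \<nu> * x \<le> C \<and>
       \<bar>(U x + 2 * \<nu> * x)\<^sup>2 - 2 * P c x\<bar> \<le> C * \<nu>"
    if adm: "admissible \<kappa> M \<nu> c U" and "\<nu> < 1" and x: "x \<in> {-1<..<1}" for \<nu> c U x
  proof -
    define Y where "Y = U x + 2 * \<nu> * x"
    define R where "R = sqrt (2 * (P c x + 2 * \<nu>\<^sup>2) + (4 * M / \<kappa> * \<nu>)\<^sup>2)"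
    have \<nu>: "\<nu> > 0" and cM: "\<And>i. \<bar>c $ i\<bar> \<le> M" and up: "is_upper_solution \<nu> c U"
      and low: "\<And>x. x \<in> {-1<..<1} \<Longrightarrow> \<kappa> * (1 - x\<^sup>2) \<le> P c x + 2 * \<nu>\<^sup>2"
      using adm by (auto simp: admissible_def)
    have p: "((\<lambda>x. P c x + 2 * \<nu>\<^sup>2) has_real_derivative - c $ 1 + c $ 2 - 2 * x * c $ 3) (at x)" for x
      unfolding P_def by (auto intro!: derivative_eq_intros)
    have p': "\<bar>- c $ 1 + c $ 2 - 2 * x * c $ 3\<bar> \<le> 4 * M" if "x \<in> {-1<..<1}" for x
    proof -
      have "\<bar>x * c $ 3\<bar> \<le> 1 * M"
        unfolding abs_mult using that cM by (intro mult_mono) auto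
      thus ?thesis using cM[of 1] cM[of 2] by linarith
    qed
    \<comment> \<open>\<open>4 M\<close> bounds the derivative of \<open>P c\<close>, so the barriers have \<open>a = B \<nu>\<close>.\<close>
    have "4 * M > 0" using assms(2) by simp
    from maximal_solution_near_sqrt[OF \<nu> assms(1) this upper_imp_maximal_riccati[OF \<nu> up] p p' low x]
    have "0 \<le> Y \<and> \<bar>Y - R\<bar> \<le> 4 * M / \<kappa> * \<nu>"
      by (simp add: Y_def R_def)
    hence Y: "0 \<le> Y" and YR: "\<bar>Y - R\<bar> \<le> B * \<nu>" by (auto simp: B_def)
    have "0 \<le> P c x + 2 * \<nu>\<^sup>2"
      using low[OF x] one_minus_sq_pos[OF x] assms(1)
      by (meson less_imp_le mult_nonneg_nonneg order_trans)
    hence rad: "0 \<le> 2 * (P c x + 2 * \<nu>\<^sup>2) + (4 * M / \<kappa> * \<nu>)\<^sup>2"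
      by (intro add_nonneg_nonneg) auto
    hence "R\<^sup>2 = 2 * (P c x + 2 * \<nu>\<^sup>2) + (B * \<nu>)\<^sup>2" by (simp add: R_def B_def)
    hence R2: "R\<^sup>2 = 2 * P c x + (4 + B\<^sup>2) * \<nu>\<^sup>2"
      by (simp add: power_mult_distrib distrib_right)
    have R0: "R \<ge> 0" using rad by (simp add: R_def)
    have \<nu>2: "\<nu>\<^sup>2 \<le> \<nu>" using \<nu> \<open>\<nu> < 1\<close> by (simp add: power2_eq_square)
    have "(4 + B\<^sup>2) * \<nu>\<^sup>2 \<le> (4 + B\<^sup>2) * 1"
      using \<nu>2 \<open>\<nu> < 1\<close> by (intro mult_left_mono) auto
    hence "R\<^sup>2 \<le> 10 * M + 4 + B\<^sup>2"
      using R2 abs_P_le[of c M x] cM x by fastforce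
    hence RL: "R \<le> L" unfolding L_def by (rule real_le_rsqrt)
    have "B * \<nu> \<le> B" using B \<open>\<nu> < 1\<close> by simp
    hence YL: "Y \<le> L + B" using YR RL by linarith
    have "\<bar>Y\<^sup>2 - R\<^sup>2\<bar> = \<bar>Y - R\<bar> * (Y + R)"
      using Y R0 by (simp add: power2_eq_square square_diff_square_factored abs_mult)
    also have "\<dots> \<le> B * \<nu> * (2 * L + B)"
      using YR YL RL Y R0 B \<nu> by (intro mult_mono) auto
    finally have "\<bar>Y\<^sup>2 - R\<^sup>2\<bar> \<le> B * (2 * L + B) * \<nu>" by (simp add: mult_ac)
    moreover have "0 \<le> (4 + B\<^sup>2) * \<nu>\<^sup>2" "(4 + B\<^sup>2) * \<nu>\<^sup>2 \<le> (4 + B\<^sup>2) * \<nu>"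
      using \<nu>2 by (auto intro!: mult_left_mono)
    moreover have "0 \<le> (L + B) * \<nu>" using L B \<nu> by simp
    moreover have "C * \<nu> = (L + B) * \<nu> + (B * (2 * L + B) * \<nu> + (4 + B\<^sup>2) * \<nu>)"
      by (simp add: C_def distrib_right)
    ultimately have "\<bar>Y\<^sup>2 - 2 * P c x\<bar> \<le> C * \<nu>"
      using R2 by linarith
    moreover have "Y \<le> C" using YL L B by (auto simp: C_def intro: order_trans)
    ultimately show ?thesis using Y by (simp add: Y_def)
  qed
  with C show ?thesis using that by blast
qed

lemma upper_quadratic_estimate:
  assumes "\<kappa> > 0" "M > 0"
  obtains C where "C > 0"
    "\<And>\<nu> c U x. admissible \<kappa> M \<nu> c U \<Longrightarrow> \<nu> < 1 \<Longrightarrow> x \<in> {-1<..<1} \<Longrightarrow>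
       \<bar>(1/2) * (U x)\<^sup>2 - P c x\<bar> \<le> C * \<nu>"
proof -
  obtain C where C: "C > 0" "\<And>\<nu> c U x. admissible \<kappa> M \<nu> c U \<Longrightarrow> \<nu> < 1 \<Longrightarrow> x \<in> {-1<..<1} \<Longrightarrow>
       0 \<le> U x + 2 * \<nu> * x \<and> U x + 2 * \<nu> * x \<le> C \<and>
       \<bar>(U x + 2 * \<nu> * x)\<^sup>2 - 2 * P c x\<bar> \<le> C * \<nu>"
    using upper_shift_bounds[OF assms] by metis
  have "\<bar>(1/2) * (U x)\<^sup>2 - P c x\<bar> \<le> (3 * C + 2) * \<nu>"
    if adm: "admissible \<kappa> M \<nu> c U" "\<nu> < 1" "x \<in> {-1<..<1}" for \<nu> c U x
  proof -
    define Y where "Y = U x + 2 * \<nu> * x"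
    have \<nu>: "\<nu> > 0" using adm by (simp add: admissible_def)
    have Y: "0 \<le> Y" "Y \<le> C" "\<bar>Y\<^sup>2 - 2 * P c x\<bar> \<le> C * \<nu>"
      using C(2)[OF adm] by (auto simp: Y_def)
    have U: "(1/2) * (U x)\<^sup>2 = Y\<^sup>2 / 2 - 2 * (\<nu> * (x * Y)) + 2 * (\<nu> * (\<nu> * x\<^sup>2))"
      by (simp add: Y_def power2_eq_square field_simps)
    have "\<bar>x * Y\<bar> \<le> 1 * C" unfolding abs_mult using Y adm by (intro mult_mono) auto
    hence "\<bar>\<nu> * (x * Y)\<bar> \<le> \<nu> * C" unfolding abs_mult using \<nu> by (intro mult_mono) auto
    moreover have "\<nu> * x\<^sup>2 \<le> 1 * 1"
      using \<nu> adm one_minus_sq_pos[OF adm(3)] by (intro mult_mono) auto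
    hence "\<nu> * (\<nu> * x\<^sup>2) \<le> \<nu> * 1" using \<nu> by (intro mult_left_mono) auto
    moreover have "0 \<le> \<nu> * (\<nu> * x\<^sup>2)" using \<nu> by simp
    ultimately have "\<bar>(1/2) * (U x)\<^sup>2 - P c x\<bar> \<le> C * \<nu> / 2 + 2 * (\<nu> * C) + 2 * \<nu>"
      using Y(3) unfolding U by linarith
    moreover have "0 \<le> C * \<nu>" using C(1) \<nu> by simp
    ultimately show ?thesis by (simp add: algebra_simps)
  qed
  thus ?thesis using that[of "3 * C + 2"] C(1) by simp
qed

lemma abs_diff_sqrt_le:
  fixes a b :: real
  assumes "a \<ge> 0" "b \<ge> 0"
  shows "\<bar>a - sqrt b\<bar> \<le> sqrt \<bar>a\<^sup>2 - b\<bar>"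
proof (rule real_le_rsqrt)
  have "\<bar>a - sqrt b\<bar>\<^sup>2 = \<bar>a - sqrt b\<bar> * \<bar>a - sqrt b\<bar>" by (simp add: power2_eq_square)
  also have "\<dots> \<le> \<bar>a - sqrt b\<bar> * \<bar>a + sqrt b\<bar>"
    using assms by (intro mult_left_mono) (auto simp: abs_le_iff)
  also have "\<dots> = \<bar>(a - sqrt b) * (a + sqrt b)\<bar>" by (simp add: abs_mult)
  also have "(a - sqrt b) * (a + sqrt b) = a\<^sup>2 - b"
    using assms by (simp add: power2_eq_square algebra_simps)
  finally show "\<bar>a - sqrt b\<bar>\<^sup>2 \<le> \<bar>a\<^sup>2 - b\<bar>" .
qed

text \<open>
  Near a zero of \<open>P c0\<close> the square root is only Hoelder continuous, which is why the distance of \<open>c\<close> and \<open>c0\<close>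
  enters under a root.
\<close>

lemma upper_near_limit:
  assumes "\<kappa> > 0" "M > 0"
  obtains C where "C > 0"
    "\<And>\<nu> c c0 U x. admissible \<kappa> M \<nu> c U \<Longrightarrow> \<nu> < 1 \<Longrightarrow> x \<in> {-1<..<1} \<Longrightarrow> 0 \<le> P c0 x \<Longrightarrow>
       \<bar>U x - sqrt (2 * P c0 x)\<bar> \<le> 2 * \<nu> +
         sqrt (C * \<nu> + 4 * (\<bar>c $ 1 - c0 $ 1\<bar> + \<bar>c $ 2 - c0 $ 2\<bar> + \<bar>c $ 3 - c0 $ 3\<bar>))"
proof -
  obtain C where C: "C > 0" "\<And>\<nu> c U x. admissible \<kappa> M \<nu> c U \<Longrightarrow> \<nu> < 1 \<Longrightarrow> x \<in> {-1<..<1} \<Longrightarrow>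
       0 \<le> U x + 2 * \<nu> * x \<and> U x + 2 * \<nu> * x \<le> C \<and>
       \<bar>(U x + 2 * \<nu> * x)\<^sup>2 - 2 * P c x\<bar> \<le> C * \<nu>"
    using upper_shift_bounds[OF assms] by metis
  show ?thesis
  proof (rule that[OF C(1)])
    fix \<nu> c c0 U x
    assume adm: "admissible \<kappa> M \<nu> c U" "\<nu> < 1" "x \<in> {-1<..<1}" and P0: "0 \<le> P c0 x"
    define Y where "Y = U x + 2 * \<nu> * x"
    define d where "d = \<bar>c $ 1 - c0 $ 1\<bar> + \<bar>c $ 2 - c0 $ 2\<bar> + \<bar>c $ 3 - c0 $ 3\<bar>"
    have \<nu>: "\<nu> > 0" using adm by (simp add: admissible_def)
    have Y: "0 \<le> Y" "\<bar>Y\<^sup>2 - 2 * P c x\<bar> \<le> C * \<nu>"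
      using C(2)[OF adm] by (auto simp: Y_def)
    have sq: "-1 \<le> x\<^sup>2" using zero_le_power2[of x] by linarith
    have "\<bar>(c $ 1 - c0 $ 1) * (1 - x)\<bar> \<le> \<bar>c $ 1 - c0 $ 1\<bar> * 2"
      "\<bar>(c $ 2 - c0 $ 2) * (1 + x)\<bar> \<le> \<bar>c $ 2 - c0 $ 2\<bar> * 2"
      "\<bar>(c $ 3 - c0 $ 3) * (1 - x\<^sup>2)\<bar> \<le> \<bar>c $ 3 - c0 $ 3\<bar> * 2"
      unfolding abs_mult using adm(3) one_minus_sq_pos[OF adm(3)] sq
      by (intro mult_left_mono; simp)+
    moreover have "P c x - P c0 x = (c $ 1 - c0 $ 1) * (1 - x) + (c $ 2 - c0 $ 2) * (1 + x)
        + (c $ 3 - c0 $ 3) * (1 - x\<^sup>2)"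
      by (simp add: P_def algebra_simps)
    moreover have "\<bar>p\<bar> \<le> 2 * (k1 + k2 + k3)"
      if "\<bar>t1\<bar> \<le> k1 * 2" "\<bar>t2\<bar> \<le> k2 * 2" "\<bar>t3\<bar> \<le> k3 * 2" "p = t1 + t2 + t3"
      for p t1 t2 t3 k1 k2 k3 :: real
      using that unfolding abs_le_iff distrib_left by linarith
    ultimately have "\<bar>P c x - P c0 x\<bar> \<le> 2 * d"
      unfolding d_def by blast
    hence "\<bar>Y\<^sup>2 - 2 * P c0 x\<bar> \<le> C * \<nu> + 4 * d" using Y(2) by linarith
    moreover have "\<bar>Y - sqrt (2 * P c0 x)\<bar> \<le> sqrt \<bar>Y\<^sup>2 - 2 * P c0 x\<bar>"
      using Y(1) P0 by (intro abs_diff_sqrt_le) auto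
    ultimately have "\<bar>Y - sqrt (2 * P c0 x)\<bar> \<le> sqrt (C * \<nu> + 4 * d)"
      using real_sqrt_le_mono order_trans by blast
    moreover have "\<bar>2 * \<nu> * x\<bar> \<le> 2 * \<nu> * 1"
      unfolding abs_mult using \<nu> adm by (intro mult_mono) auto
    ultimately show "\<bar>U x - sqrt (2 * P c0 x)\<bar> \<le> 2 * \<nu> +
         sqrt (C * \<nu> + 4 * (\<bar>c $ 1 - c0 $ 1\<bar> + \<bar>c $ 2 - c0 $ 2\<bar> + \<bar>c $ 3 - c0 $ 3\<bar>))"
      unfolding Y_def d_def[symmetric] by linarith
  qed
qed

text \<open>
  The limit \<open>\<nu> \<rightarrow> 0\<close> over all admissible triples at once, whatever \<open>c\<close> and \<open>U\<close> are.
\<close>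

definition vanishing_filter ::
  "real \<Rightarrow> real \<Rightarrow> (real \<times> (real ^ 3) \<times> (real \<Rightarrow> real)) filter" where
  "vanishing_filter \<kappa> M =
     inf (filtercomap fst (at_right 0)) (principal {(\<nu>, c, U). admissible \<kappa> M \<nu> c U})"

lemma eventually_vanishing_filter:
  "eventually Q (vanishing_filter \<kappa> M) \<longleftrightarrow>
     (\<exists>d>0. \<forall>\<nu> c U. \<nu> < d \<longrightarrow> admissible \<kappa> M \<nu> c U \<longrightarrow> Q (\<nu>, c, U))"
proof
  assume "eventually Q (vanishing_filter \<kappa> M)"
  then obtain R where R: "eventually R (at_right (0::real))"
    "\<And>\<nu> c U. R \<nu> \<Longrightarrow> admissible \<kappa> M \<nu> c U \<Longrightarrow> Q (\<nu>, c, U)"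
    unfolding vanishing_filter_def eventually_inf_principal eventually_filtercomap by auto
  then obtain d where "d > 0" "\<And>y. 0 < y \<Longrightarrow> y < d \<Longrightarrow> R y"
    unfolding eventually_at_right_field by auto
  with R(2) show "\<exists>d>0. \<forall>\<nu> c U. \<nu> < d \<longrightarrow> admissible \<kappa> M \<nu> c U \<longrightarrow> Q (\<nu>, c, U)"
    by (intro exI[of _ d]) (auto simp: admissible_def)
next
  assume "\<exists>d>0. \<forall>\<nu> c U. \<nu> < d \<longrightarrow> admissible \<kappa> M \<nu> c U \<longrightarrow> Q (\<nu>, c, U)"
  then obtain d where d: "d > 0" "\<And>\<nu> c U. \<nu> < d \<Longrightarrow> admissible \<kappa> M \<nu> c U \<Longrightarrow> Q (\<nu>, c, U)" by auto
  have "eventually (\<lambda>\<nu>. \<nu> < d) (at_right (0::real))"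
    unfolding eventually_at_right_field using d(1) by auto
  thus "eventually Q (vanishing_filter \<kappa> M)"
    unfolding vanishing_filter_def eventually_inf_principal eventually_filtercomap
    using d(2) by (intro exI[of _ "\<lambda>\<nu>. \<nu> < d"]) auto
qed

text \<open>
  On a compact part of \<open>(-1,1)\<close> the bounds on \<open>(U + 2 \<nu> x)\<^sup>2\<close> make \<open>U\<close> and \<open>P c\<close> bounded below by a positive
  constant for small \<open>\<nu>\<close>; this positivity is the damping that the interior regularity argument needs.
\<close>

lemma upper_interior_estimate:
  assumes "\<kappa> > 0" "M > 0" and "0 < \<epsilon>" "\<epsilon> < 1"
  obtains C d where "d > 0"
    "\<And>\<nu> c U j x. admissible \<kappa> M \<nu> c U \<Longrightarrow> \<nu> < d \<Longrightarrow> j \<le> m \<Longrightarrow> x \<in> {-1 + \<epsilon><..<1 - \<epsilon>} \<Longrightarrow>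
       (deriv ^^ j) (\<lambda>x. (U x - sqrt (2 * P c x)) / \<nu>) differentiable (at x) \<and>
       \<bar>(deriv ^^ j) (\<lambda>x. (U x - sqrt (2 * P c x)) / \<nu>) x\<bar> \<le> C"
proof -
  obtain C where C: "C > 0" "\<And>\<nu> c U x. admissible \<kappa> M \<nu> c U \<Longrightarrow> \<nu> < 1 \<Longrightarrow> x \<in> {-1<..<1} \<Longrightarrow>
       0 \<le> U x + 2 * \<nu> * x \<and> U x + 2 * \<nu> * x \<le> C \<and>
       \<bar>(U x + 2 * \<nu> * x)\<^sup>2 - 2 * P c x\<bar> \<le> C * \<nu>"
    using upper_shift_bounds[OF assms(1,2)] by metis
  let ?F = "vanishing_filter \<kappa> M"
  let ?n = "fst :: real \<times> (real ^ 3) \<times> (real \<Rightarrow> real) \<Rightarrow> real"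
  let ?q = "\<lambda>i :: real \<times> (real ^ 3) \<times> (real \<Rightarrow> real). P (fst (snd i))"
  let ?U = "\<lambda>i :: real \<times> (real ^ 3) \<times> (real \<Rightarrow> real). snd (snd i)"
  have "bdd_derivs (Suc m) ?F {-1 + \<epsilon><..<1 - \<epsilon>}
      (\<lambda>i x. (?U i x - sqrt (2 * ?q i x)) / ?n i)"
  proof (rule interior_bdd_derivs)
    show n0: "\<forall>\<^sub>F i in ?F. 0 < ?n i"
      unfolding eventually_vanishing_filter by (auto simp: admissible_def intro!: exI[of _ 1])
    show "(?n \<longlongrightarrow> 0) ?F"
    proof (rule tendstoI)
      fix e :: real assume "e > 0"
      thus "\<forall>\<^sub>F i in ?F. dist (?n i) 0 < e"
        unfolding eventually_vanishing_filter by (auto simp: admissible_def intro!: exI[of _ e])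
    qed
    show "bdd_derivs m ?F {-1<..<1} ?q" for m
    proof -
      have coeff: "bdd_derivs m ?F {-1<..<1} (\<lambda>i x. fst (snd i) $ j)" for j
        by (rule bdd_derivs_const[where C = M])
           (auto simp: eventually_vanishing_filter admissible_def intro!: exI[of _ 1])
      have id: "bdd_derivs m ?F {-1<..<1} (\<lambda>i x. x)" by (rule bdd_derivs_ident) auto
      show ?thesis unfolding P_def power2_eq_square
        by (intro bdd_derivs_add bdd_derivs_diff bdd_derivs_mult coeff id
            bdd_derivs_const[where C = 1 and k = "\<lambda>_. 1"]) auto
    qed
    show "\<forall>\<^sub>F i in ?F. \<forall>x\<in>{-1<..<1}. ?U i differentiable (at x) \<and>
        ?n i * (1 - x\<^sup>2) * deriv (?U i) x + 2 * ?n i * x * ?U i x + (?U i x)\<^sup>2 / 2 = ?q i x"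
      unfolding eventually_vanishing_filter
      by (auto simp: admissible_def is_upper_solution_def is_solution_def C1_differentiable_on_eq
          intro!: exI[of _ 1])
    have "\<forall>\<^sub>F i in ?F. \<forall>x\<in>{-1<..<1}. \<bar>?U i x\<bar> \<le> C + 2"
      unfolding eventually_vanishing_filter
    proof (intro exI[of _ 1] conjI allI impI ballI)
      fix \<nu> c U and x :: real
      assume a: "\<nu> < 1" "admissible \<kappa> M \<nu> c U" "x \<in> {-1<..<1}"
      hence "\<nu> > 0" by (simp add: admissible_def)
      hence "\<bar>\<nu> * x\<bar> \<le> 1 * 1" unfolding abs_mult using a by (intro mult_mono) auto
      thus "\<bar>?U (\<nu>, c, U) x\<bar> \<le> C + 2" using C(2)[OF a(2,1,3)] by auto
    qed auto
    thus "bdd_derivs 0 ?F {-1<..<1} ?U" by auto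
    show "\<exists>\<delta>>0. \<forall>\<^sub>F i in ?F. \<forall>x\<in>{a<..<b}. ?U i x \<ge> \<delta> \<and> ?q i x \<ge> \<delta>"
      if ab: "-1 < a" "b < 1" for a b
    proof -
      define e where "e = \<kappa> * ((1 - b) * (1 + a))"
      have e: "e > 0" using ab assms by (simp add: e_def)
      define \<delta> where "\<delta> = min (e / 2) (sqrt e / 4)"
      have \<delta>: "\<delta> > 0" using e by (simp add: \<delta>_def)
      \<comment> \<open>These four bounds on \<open>\<nu>\<close> give, in turn, \<open>\<nu>\<^sup>2 \<le> \<nu>\<close>, \<open>P c \<ge> e / 2\<close>, \<open>(U + 2 \<nu> x)\<^sup>2 \<ge> e / 4\<close> and \<open>U \<ge> sqrt e / 4\<close>.\<close>
      define d where "d = min 1 (min (e / 4) (min (e / (4 * C)) (sqrt e / 8)))"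
      have d: "d > 0" using e C(1) by (simp add: d_def)
      have "\<forall>\<^sub>F i in ?F. \<forall>x\<in>{a<..<b}. ?U i x \<ge> \<delta> \<and> ?q i x \<ge> \<delta>"
        unfolding eventually_vanishing_filter
      proof (intro exI[of _ d] conjI allI impI ballI d)
        fix \<nu> c U and x :: real
        assume a: "\<nu> < d" "admissible \<kappa> M \<nu> c U" and x: "x \<in> {a<..<b}"
        have \<nu>: "\<nu> > 0" using a by (simp add: admissible_def)
        have \<nu>d: "\<nu> < 1" "4 * \<nu> < e" "\<nu> < e / (4 * C)" "8 * \<nu> < sqrt e"
          using a(1) by (auto simp: d_def)
        have C\<nu>: "C * \<nu> < e / 4" using \<nu>d(3) C(1) by (simp add: field_simps)
        have x': "x \<in> {-1<..<1}" using x ab by auto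
        have "(1 - b) * (1 + a) \<le> (1 - x) * (1 + x)"
          using x ab by (intro mult_mono) auto
        hence "e \<le> \<kappa> * (1 - x\<^sup>2)"
          unfolding e_def using assms(1)
          by (intro mult_left_mono) (auto simp: power2_eq_square algebra_simps)
        also have "\<dots> \<le> P c x + 2 * \<nu>\<^sup>2" using a(2) x' by (simp add: admissible_def)
        finally have eP: "e \<le> P c x + 2 * \<nu>\<^sup>2" .
        have "\<nu>\<^sup>2 \<le> \<nu>" using \<nu> \<nu>d(1) by (simp add: power2_eq_square)
        hence P: "P c x \<ge> e / 2" using eP \<nu>d(2) by linarith
        define Y where "Y = U x + 2 * \<nu> * x"
        have Y: "0 \<le> Y" "\<bar>Y\<^sup>2 - 2 * P c x\<bar> \<le> C * \<nu>"
          using C(2)[OF a(2) \<nu>d(1) x'] by (auto simp: Y_def)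
        have "(sqrt e / 2)\<^sup>2 = e / 4" using e by (simp add: power_divide)
        also have "\<dots> \<le> Y\<^sup>2" using Y(2) P C\<nu> e by linarith
        finally have "sqrt e / 2 \<le> Y" using Y(1) by (rule power2_le_imp_le)
        moreover have "\<nu> * x \<le> \<nu> * 1" using x' \<nu> by (intro mult_left_mono) auto
        ultimately have "U x \<ge> sqrt e / 4" using \<nu>d(4) by (simp add: Y_def)
        with P show "?U (\<nu>, c, U) x \<ge> \<delta>" "?q (\<nu>, c, U) x \<ge> \<delta>"
          by (auto simp: \<delta>_def min_le_iff_disj)
      qed
      with \<delta> show ?thesis by blast
    qed
  qed (use assms in auto)
  from bdd_derivs_funpow[OF this] obtain K where
    "\<forall>\<^sub>F i in ?F. \<forall>j\<le>m. \<forall>x\<in>{-1 + \<epsilon><..<1 - \<epsilon>}.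
      (deriv ^^ j) (\<lambda>x. (?U i x - sqrt (2 * ?q i x)) / ?n i) differentiable (at x) \<and>
      \<bar>(deriv ^^ j) (\<lambda>x. (?U i x - sqrt (2 * ?q i x)) / ?n i) x\<bar> \<le> K"
    by auto
  then obtain d where "d > 0" and d: "\<And>\<nu> c U. \<nu> < d \<Longrightarrow> admissible \<kappa> M \<nu> c U \<Longrightarrow>
      \<forall>j\<le>m. \<forall>x\<in>{-1 + \<epsilon><..<1 - \<epsilon>}.
        (deriv ^^ j) (\<lambda>x. (U x - sqrt (2 * P c x)) / \<nu>) differentiable (at x) \<and>
        \<bar>(deriv ^^ j) (\<lambda>x. (U x - sqrt (2 * P c x)) / \<nu>) x\<bar> \<le> K"
    unfolding eventually_vanishing_filter by auto
  show ?thesis by (rule that[OF \<open>d > 0\<close>]) (use d in blast)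
qed

section \<open>The norms\<close>

text \<open>
  Stated with a factor \<open>s = \<plusminus>1\<close> inside so that it serves for the upper solution and, after the reflection,
  for the lower one.
\<close>

lemma C_norm_affine_le:
  fixes f :: "real \<Rightarrow> real" and s a C :: real
  assumes "open S" "\<bar>s\<bar> = 1" "\<And>x. x \<in> S \<Longrightarrow> s * x \<in> S" "C \<ge> 0"
    and d: "\<And>j x. j \<le> m \<Longrightarrow> x \<in> S \<Longrightarrow>
          (deriv ^^ j) f differentiable (at x) \<and> \<bar>(deriv ^^ j) f x\<bar> \<le> C"
  shows "C_norm m S (\<lambda>x. a * f (s * x)) \<le> ennreal (real (Suc m) * C * \<bar>a\<bar>)"
proof -
  let ?g = "\<lambda>x. a * f (s * x)"
  have g: "(deriv ^^ j) ?g x = a * s ^ j * (deriv ^^ j) f (s * x)" if "j \<le> m" "x \<in> S" for j x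
    using assms(1,3) d that by (intro funpow_deriv_affine[where S = S and S' = S and m = m]) auto
  have gd: "(deriv ^^ j) ?g differentiable (at x)" if j: "j \<le> m" and x: "x \<in> S" for j x
  proof (rule differentiable_eq_on_open[OF assms(1) x])
    show "a * s ^ j * (deriv ^^ j) f (s * y) = (deriv ^^ j) ?g y" if "y \<in> S" for y
      using g[OF j that] by simp
    have "((deriv ^^ j) f has_real_derivative deriv ((deriv ^^ j) f) (s * x)) (at (s * x))"
      using d[OF j] assms(3)[OF x] by (intro has_real_derivative_deriv) auto
    moreover have "((\<lambda>x. s * x) has_real_derivative s) (at x)"
      by (auto intro!: derivative_eq_intros)
    ultimately have "((\<lambda>x. (deriv ^^ j) f (s * x)) has_real_derivative
        deriv ((deriv ^^ j) f) (s * x) * s) (at x)"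
      by (rule DERIV_chain2)
    from DERIV_cmult[OF this, of "a * s ^ j"]
    show "(\<lambda>y. a * s ^ j * (deriv ^^ j) f (s * y)) differentiable (at x)"
      by (auto simp: real_differentiable_def)
  qed
  have "continuous_on S ((deriv ^^ m) ?g)"
    using gd[of m] by (intro continuous_at_imp_continuous_on ballI differentiable_imp_continuous_within) auto
  hence "C_differentiable_on m S ?g" using gd by (auto simp: C_differentiable_on_def)
  hence "C_norm m S ?g = (\<Sum>i\<le>m. SUP x\<in>S. ennreal \<bar>(deriv ^^ i) ?g x\<bar>)"
    by (simp add: C_norm_def)
  also have "\<dots> \<le> (\<Sum>i\<le>m. ennreal (C * \<bar>a\<bar>))"
  proof (intro sum_mono SUP_least ennreal_leI)
    fix i x assume i: "i \<in> {..m}" and x: "x \<in> S"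
    have "\<bar>(deriv ^^ i) ?g x\<bar> = \<bar>a\<bar> * \<bar>(deriv ^^ i) f (s * x)\<bar>"
      using g[of i x] i x assms(2) by (simp add: abs_mult power_abs)
    also have "\<dots> \<le> \<bar>a\<bar> * C" using d[of i "s * x"] i assms(3)[OF x] by (intro mult_left_mono) auto
    finally show "\<bar>(deriv ^^ i) ?g x\<bar> \<le> C * \<bar>a\<bar>" by (simp add: mult_ac)
  qed
  also have "\<dots> = ennreal (real (Suc m)) * ennreal (C * \<bar>a\<bar>)"
    by (simp add: ennreal_of_nat_eq_real_of_nat)
  also have "\<dots> = ennreal (real (Suc m) * C * \<bar>a\<bar>)"
    using assms(4) by (subst ennreal_mult[symmetric]) (auto simp: mult_ac)
  finally show ?thesis .
qed

lemma Linf_norm_le: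
  assumes "continuous_on {-1<..<1} f" "\<And>x. x \<in> {-1<..<1} \<Longrightarrow> \<bar>f x\<bar> \<le> K"
  shows "Linf_norm {-1<..<1} f \<le> ennreal K"
  unfolding Linf_norm_def
proof (rule esssup_I)
  have "f \<in> borel_measurable (lebesgue_on {-1<..<1})"
    using assms(1) by (intro continuous_imp_measurable_on_sets_lebesgue) auto
  thus "(\<lambda>x. ennreal \<bar>f x\<bar>) \<in> borel_measurable (lebesgue_on {-1<..<1})" by measurable
  show "AE x in lebesgue_on {-1<..<1}. ennreal \<bar>f x\<bar> \<le> ennreal K"
    using assms(2) by (intro AE_I2 ennreal_leI) auto
qed

section \<open>Vanishing viscosity sequences\<close>

lemma vanishing_viscosity_seq_nonneg:
  assumes "vanishing_viscosity_seq \<nu> cs c"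
  shows "0 \<le> c $ 1" and "0 \<le> c $ 2"
proof -
  have conv: "\<nu> \<longlonglongrightarrow> 0" "cs \<longlonglongrightarrow> c" using assms by (auto simp: vanishing_viscosity_seq_def)
  have lim: "(\<lambda>k. - (\<nu> k)\<^sup>2) \<longlonglongrightarrow> - 0\<^sup>2" "(\<lambda>k. cs k $ i) \<longlonglongrightarrow> c $ i" for i
    by (intro tendsto_intros conv)+
  have "- (\<nu> k)\<^sup>2 \<le> cs k $ 1" "- (\<nu> k)\<^sup>2 \<le> cs k $ 2" for k
    using assms by (auto simp: vanishing_viscosity_seq_def J_def)
  thus "0 \<le> c $ 1" "0 \<le> c $ 2"
    using LIMSEQ_le[OF lim(1) lim(2)[of 1]] LIMSEQ_le[OF lim(1) lim(2)[of 2]] by auto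
qed

text \<open>
  With \<open>A = c\<^sub>1 + t\<close> and \<open>B = c\<^sub>2 + t\<close> nonnegative, \<open>P c + 2 t\<close> equals
  \<open>(A / 2 + c\<^sub>3) (1 - x\<^sup>2) + A (1 - x)\<^sup>2 / 2 + B (1 + x)\<close>, and likewise with the two ends exchanged. If the
  limit has \<open>c\<^sub>1 = 0\<close> or \<open>c\<^sub>2 = 0\<close>, one of the two choices loses nothing in the limit. The case of
  interest is \<open>t = \<nu>\<^sup>2\<close>.
\<close>

lemma P_lower_bound:
  assumes "- t \<le> c $ 1" "- t \<le> c $ 2"
    and "2 * \<kappa> \<le> c $ 1 + t + 2 * c $ 3 \<or> 2 * \<kappa> \<le> c $ 2 + t + 2 * c $ 3"
    and x: "x \<in> {-1<..<1}"
  shows "\<kappa> * (1 - x\<^sup>2) \<le> P c x + 2 * t"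
proof -
  define A B where "A = c $ 1 + t" and "B = c $ 2 + t"
  have AB: "0 \<le> A" "0 \<le> B" using assms by (auto simp: A_def B_def)
  have P: "P c x + 2 * t = A * (1 - x) + B * (1 + x) + c $ 3 * (1 - x\<^sup>2)"
    by (simp add: P_def A_def B_def algebra_simps)
  note pos = one_minus_sq_pos[OF x]
  from assms(3) show ?thesis
  proof
    assume "2 * \<kappa> \<le> c $ 1 + t + 2 * c $ 3"
    hence "\<kappa> * (1 - x\<^sup>2) \<le> (A / 2 + c $ 3) * (1 - x\<^sup>2)"
      using pos by (intro mult_right_mono) (simp_all add: A_def add_divide_distrib)
    moreover have "P c x + 2 * t - (A / 2 + c $ 3) * (1 - x\<^sup>2) = A * (1 - x)\<^sup>2 / 2 + B * (1 + x)"
      unfolding P by (simp add: power2_eq_square field_simps)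
    moreover have "0 \<le> A * (1 - x)\<^sup>2 / 2" "0 \<le> B * (1 + x)"
      using AB x by simp_all
    ultimately show ?thesis by linarith
  next
    assume "2 * \<kappa> \<le> c $ 2 + t + 2 * c $ 3"
    hence "\<kappa> * (1 - x\<^sup>2) \<le> (B / 2 + c $ 3) * (1 - x\<^sup>2)"
      using pos by (intro mult_right_mono) (simp_all add: B_def add_divide_distrib)
    moreover have "P c x + 2 * t - (B / 2 + c $ 3) * (1 - x\<^sup>2) = A * (1 - x) + B * (1 + x)\<^sup>2 / 2"
      unfolding P by (simp add: power2_eq_square field_simps)
    moreover have "0 \<le> A * (1 - x)" "0 \<le> B * (1 + x)\<^sup>2 / 2"
      using AB x by simp_all
    ultimately show ?thesis by linarith
  qed
qed

text \<open>
  When \<open>c\<^sub>1, c\<^sub>2 \<ge> 0\<close> and \<open>c\<^sub>1 c\<^sub>2 = 0\<close>, the hypothesis on \<open>c\<^sub>3\<close> says that \<open>c\<^sub>1 + c\<^sub>2 + 2 c\<^sub>3 > 0\<close>. A quarter of this number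
  serves as \<open>\<kappa>\<close>; half of it would be attained in the limit and leave no room for \<open>cs k\<close>.
\<close>

lemma eventually_admissible:
  fixes c :: "real ^ 3"
  assumes c: "c $ 1 * c $ 2 = 0" "c $ 3 > c3_star (c $ 1) (c $ 2)"
    and nonneg: "0 \<le> c $ 1" "0 \<le> c $ 2"
  obtains \<kappa> M where "\<kappa> > 0" "M > 0" "\<And>x. x \<in> {-1<..<1} \<Longrightarrow> 0 \<le> P c x"
    "\<And>\<nu> cs Up Um. vanishing_viscosity_seq \<nu> cs c \<Longrightarrow>
        \<forall>k. is_upper_solution (\<nu> k) (cs k) (Up k) \<Longrightarrow>
        \<forall>k. is_lower_solution (\<nu> k) (cs k) (Um k) \<Longrightarrow>
        \<forall>\<^sub>F k in sequentially. admissible \<kappa> M (\<nu> k) (cs k) (Up k) \<and>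
          admissible \<kappa> M (\<nu> k) (swap_ends (cs k)) (\<lambda>x. - Um k (- x))"
proof -
  define \<kappa> where "\<kappa> = (c $ 1 + c $ 2 + 2 * c $ 3) / 4"
  define M where "M = norm c + 1"
  have M: "M > 0" by (simp add: M_def add_nonneg_pos)
  have "c3_star (c $ 1) (c $ 2) = - (c $ 1 + c $ 2) / 2"
    using c(1) nonneg by (auto simp: c3_star_def c3_bar_def)
  hence \<kappa>: "\<kappa> > 0" using c(2) by (simp add: \<kappa>_def)
  have big: "c $ 1 + 2 * c $ 3 = 4 * \<kappa> \<or> c $ 2 + 2 * c $ 3 = 4 * \<kappa>"
    using c(1) by (auto simp: \<kappa>_def)
  show ?thesis
  proof (rule that[OF \<kappa> M])
    fix x :: real assume x: "x \<in> {-1<..<1}"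
    have "\<kappa> * (1 - x\<^sup>2) \<le> P c x + 2 * 0"
      by (rule P_lower_bound) (use nonneg big \<kappa> x in auto)
    moreover have "0 < \<kappa> * (1 - x\<^sup>2)" using one_minus_sq_pos[OF x] \<kappa> by (rule mult_pos_pos[rotated])
    ultimately show "0 \<le> P c x" by linarith
  next
    fix \<nu> cs Up Um
    assume vv: "vanishing_viscosity_seq \<nu> cs c"
      and up: "\<forall>k. is_upper_solution (\<nu> k) (cs k) (Up k)"
      and lo: "\<forall>k. is_lower_solution (\<nu> k) (cs k) (Um k)"
    have \<nu>: "\<nu> k > 0" and J: "cs k \<in> J (\<nu> k)" for k
      using vv by (auto simp: vanishing_viscosity_seq_def)
    have cs: "cs \<longlonglongrightarrow> c" using vv by (simp add: vanishing_viscosity_seq_def)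
    have "(\<lambda>k. cs k $ 1 + 2 * cs k $ 3) \<longlonglongrightarrow> c $ 1 + 2 * c $ 3"
      "(\<lambda>k. cs k $ 2 + 2 * cs k $ 3) \<longlonglongrightarrow> c $ 2 + 2 * c $ 3"
      by (intro tendsto_intros cs)+
    moreover have "2 * \<kappa> < c $ 1 + 2 * c $ 3 \<or> 2 * \<kappa> < c $ 2 + 2 * c $ 3" using big \<kappa> by linarith
    ultimately have "(\<forall>\<^sub>F k in sequentially. 2 * \<kappa> < cs k $ 1 + 2 * cs k $ 3) \<or>
        (\<forall>\<^sub>F k in sequentially. 2 * \<kappa> < cs k $ 2 + 2 * cs k $ 3)"
      using order_tendstoD(1) by blast
    hence ev1: "\<forall>\<^sub>F k in sequentially. 2 * \<kappa> < cs k $ 1 + 2 * cs k $ 3 \<or> 2 * \<kappa> < cs k $ 2 + 2 * cs k $ 3"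
      by (auto elim: eventually_mono)
    have ev2: "\<forall>\<^sub>F k in sequentially. norm (cs k) < M"
      by (rule order_tendstoD(2)[OF tendsto_norm[OF cs]]) (simp add: M_def)
    show "\<forall>\<^sub>F k in sequentially. admissible \<kappa> M (\<nu> k) (cs k) (Up k) \<and>
          admissible \<kappa> M (\<nu> k) (swap_ends (cs k)) (\<lambda>x. - Um k (- x))"
      using ev1 ev2
    proof eventually_elim
      case (elim k)
      have coeff: "\<bar>cs k $ i\<bar> \<le> M" for i
        using component_le_norm_cart[of "cs k" i] elim(2) by linarith
      have low: "\<kappa> * (1 - x\<^sup>2) \<le> P (cs k) x + 2 * (\<nu> k)\<^sup>2" if "x \<in> {-1<..<1}" for x
      proof (rule P_lower_bound[OF _ _ _ that])
        show "- (\<nu> k)\<^sup>2 \<le> cs k $ 1" "- (\<nu> k)\<^sup>2 \<le> cs k $ 2" using J[of k] by (auto simp: J_def)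
        have "0 \<le> (\<nu> k)\<^sup>2" by simp
        thus "2 * \<kappa> \<le> cs k $ 1 + (\<nu> k)\<^sup>2 + 2 * cs k $ 3 \<or> 2 * \<kappa> \<le> cs k $ 2 + (\<nu> k)\<^sup>2 + 2 * cs k $ 3"
          using elim(1) by linarith
      qed
      have "\<kappa> * (1 - x\<^sup>2) \<le> P (swap_ends (cs k)) x + 2 * (\<nu> k)\<^sup>2" if "x \<in> {-1<..<1}" for x
        using low[of "- x"] that by (simp add: P_swap_ends)
      moreover have "\<bar>swap_ends (cs k) $ i\<bar> \<le> M" for i
        using coeff by (simp add: swap_ends_def)
      ultimately show ?case
        using \<nu> coeff low up lo lower_reflect_is_upper by (auto simp: admissible_def)
    qed
  qed
qed

lemma is_solution_continuous_on:
  "is_solution \<nu> c U \<Longrightarrow> continuous_on {-1<..<1} U"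
  by (auto simp: is_solution_def intro: C1_differentiable_imp_continuous_on)

lemma continuous_on_P [continuous_intros]: "continuous_on S (P c)"
  unfolding P_def by (intro continuous_intros)

lemma solutions_converge_uniformly:
  fixes c :: "real ^ 3"
  assumes c: "c $ 1 * c $ 2 = 0" "c $ 3 > c3_star (c $ 1) (c $ 2)"
    and vv: "vanishing_viscosity_seq \<nu> cs c"
    and up: "\<forall>k. is_upper_solution (\<nu> k) (cs k) (Up k)"
    and lo: "\<forall>k. is_lower_solution (\<nu> k) (cs k) (Um k)"
  shows "(\<lambda>k. Linf_norm {-1<..<1} (\<lambda>x. Up k x - sqrt (2 * P c x))) \<longlonglongrightarrow> 0"
    and "(\<lambda>k. Linf_norm {-1<..<1} (\<lambda>x. Um k x + sqrt (2 * P c x))) \<longlonglongrightarrow> 0"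
proof -
  obtain \<kappa> M where \<kappa>: "\<kappa> > 0" "M > 0" and P0: "\<And>x. x \<in> {-1<..<1} \<Longrightarrow> 0 \<le> P c x"
    and adm: "\<forall>\<^sub>F k in sequentially. admissible \<kappa> M (\<nu> k) (cs k) (Up k) \<and>
          admissible \<kappa> M (\<nu> k) (swap_ends (cs k)) (\<lambda>x. - Um k (- x))"
    by (rule eventually_admissible[OF c vanishing_viscosity_seq_nonneg[OF vv]])
       (rule that; use vv up lo in blast)
  define d where "d = (\<lambda>k. \<bar>cs k $ 1 - c $ 1\<bar> + \<bar>cs k $ 2 - c $ 2\<bar> + \<bar>cs k $ 3 - c $ 3\<bar>)"
  obtain C where C: "\<And>\<nu> c c0 U x. admissible \<kappa> M \<nu> c U \<Longrightarrow> \<nu> < 1 \<Longrightarrow> x \<in> {-1<..<1} \<Longrightarrow> 0 \<le> P c0 x \<Longrightarrow>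
       \<bar>U x - sqrt (2 * P c0 x)\<bar> \<le> 2 * \<nu> +
         sqrt (C * \<nu> + 4 * (\<bar>c $ 1 - c0 $ 1\<bar> + \<bar>c $ 2 - c0 $ 2\<bar> + \<bar>c $ 3 - c0 $ 3\<bar>))"
    using upper_near_limit[OF \<kappa>] by metis
  have \<nu>: "\<nu> \<longlonglongrightarrow> 0" and cs: "cs \<longlonglongrightarrow> c" using vv by (auto simp: vanishing_viscosity_seq_def)
  have "(\<lambda>k. 2 * \<nu> k + sqrt (C * \<nu> k + 4 * d k)) \<longlonglongrightarrow> 2 * 0 + sqrt (C * 0 +
      4 * (\<bar>c $ 1 - c $ 1\<bar> + \<bar>c $ 2 - c $ 2\<bar> + \<bar>c $ 3 - c $ 3\<bar>))"
    unfolding d_def by (intro tendsto_intros \<nu> cs)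
  hence "(\<lambda>k. ennreal (2 * \<nu> k + sqrt (C * \<nu> k + 4 * d k))) \<longlonglongrightarrow> ennreal 0"
    by (intro tendsto_ennrealI) simp
  hence lim: "(\<lambda>k. ennreal (2 * \<nu> k + sqrt (C * \<nu> k + 4 * d k))) \<longlonglongrightarrow> 0" by simp
  have small: "\<forall>\<^sub>F k in sequentially. \<nu> k < 1" using order_tendstoD(2)[OF \<nu>, of 1] by simp
  have "\<forall>\<^sub>F k in sequentially. Linf_norm {-1<..<1} (\<lambda>x. Up k x - sqrt (2 * P c x))
      \<le> ennreal (2 * \<nu> k + sqrt (C * \<nu> k + 4 * d k))"
    using adm small
  proof eventually_elim
    case (elim k)
    have "continuous_on {-1<..<1} (Up k)"
      using up is_solution_continuous_on unfolding is_upper_solution_def by blast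
    hence "continuous_on {-1<..<1} (\<lambda>x. Up k x - sqrt (2 * P c x))"
      by (intro continuous_intros)
    thus ?case
      using C[of "\<nu> k" "cs k" "Up k" _ c] elim P0 by (intro Linf_norm_le) (auto simp: d_def)
  qed
  thus "(\<lambda>k. Linf_norm {-1<..<1} (\<lambda>x. Up k x - sqrt (2 * P c x))) \<longlonglongrightarrow> 0"
    by (intro tendsto_sandwich[OF _ _ tendsto_const lim]) auto
  have "\<forall>\<^sub>F k in sequentially. Linf_norm {-1<..<1} (\<lambda>x. Um k x + sqrt (2 * P c x))
      \<le> ennreal (2 * \<nu> k + sqrt (C * \<nu> k + 4 * d k))"
    using adm small
  proof eventually_elim
    case (elim k)
    have "continuous_on {-1<..<1} (Um k)"
      using lo is_solution_continuous_on unfolding is_lower_solution_def by blast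
    hence "continuous_on {-1<..<1} (\<lambda>x. Um k x + sqrt (2 * P c x))"
      by (intro continuous_intros)
    moreover have "\<bar>Um k x + sqrt (2 * P c x)\<bar> \<le> 2 * \<nu> k + sqrt (C * \<nu> k + 4 * d k)"
      if "x \<in> {-1<..<1}" for x
    proof -
      have "- x \<in> {-1<..<1}" using that by auto
      from C[of "\<nu> k" "swap_ends (cs k)" "\<lambda>x. - Um k (- x)" "- x" "swap_ends c", OF _ _ this]
      have "\<bar>- Um k x - sqrt (2 * P c x)\<bar> \<le> 2 * \<nu> k + sqrt (C * \<nu> k + 4 * d k)"
        using elim P0[OF that] by (simp add: P_swap_ends d_def add.commute)
      thus ?thesis by linarith
    qed
    ultimately show ?case by (intro Linf_norm_le)
  qed
  thus "(\<lambda>k. Linf_norm {-1<..<1} (\<lambda>x. Um k x + sqrt (2 * P c x))) \<longlonglongrightarrow> 0"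
    by (intro tendsto_sandwich[OF _ _ tendsto_const lim]) auto
qed

text \<open>
  The quadratic quantity is \<open>O(\<nu>)\<close>, so the factor \<open>sqrt \<nu>\<close> may be replaced by \<open>1\<close>.
\<close>

lemma ennreal_rate_le:
  assumes "L \<le> ennreal (A * \<nu>)" "N \<le> ennreal (B * \<nu>)" "0 < \<nu>" "\<nu> < 1" "0 \<le> A" "0 \<le> B"
  shows "ennreal (sqrt \<nu>) * L + N \<le> ennreal ((A + B + 1) * \<nu>)"
proof -
  have "sqrt \<nu> \<le> 1" using assms by (simp add: real_sqrt_le_1_iff)
  hence "ennreal (sqrt \<nu>) * L \<le> 1 * ennreal (A * \<nu>)"
    using assms by (intro mult_mono) (auto simp flip: ennreal_1 intro: ennreal_leI)
  hence "ennreal (sqrt \<nu>) * L + N \<le> ennreal (A * \<nu>) + ennreal (B * \<nu>)"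
    using assms(2) by (intro add_mono) auto
  also have "\<dots> = ennreal (A * \<nu> + B * \<nu>)" using assms by (intro ennreal_plus[symmetric]) auto
  also have "\<dots> \<le> ennreal ((A + B + 1) * \<nu>)"
    using assms by (intro ennreal_leI) (simp add: algebra_simps)
  finally show ?thesis .
qed

lemma solutions_rate:
  fixes c :: "real ^ 3" and \<epsilon> :: real and m :: nat
  assumes c: "c $ 1 * c $ 2 = 0" "c $ 3 > c3_star (c $ 1) (c $ 2)"
    and nonneg: "0 \<le> c $ 1" "0 \<le> c $ 2" and \<epsilon>: "0 < \<epsilon>"
  obtains C where "C > 0"
    "\<And>\<nu> cs Up Um. vanishing_viscosity_seq \<nu> cs c \<Longrightarrow>
        \<forall>k. is_upper_solution (\<nu> k) (cs k) (Up k) \<Longrightarrow>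
        \<forall>k. is_lower_solution (\<nu> k) (cs k) (Um k) \<Longrightarrow>
        \<forall>\<^sub>F k in sequentially.
           ennreal (sqrt (\<nu> k)) * Linf_norm {-1<..<1} (\<lambda>x. (1/2) * (Up k x)\<^sup>2 - P (cs k) x)
             + C_norm m {-1 + \<epsilon><..<1 - \<epsilon>} (\<lambda>x. Up k x - sqrt (2 * P (cs k) x))
             \<le> ennreal (C * \<nu> k) \<and>
           ennreal (sqrt (\<nu> k)) * Linf_norm {-1<..<1} (\<lambda>x. (1/2) * (Um k x)\<^sup>2 - P (cs k) x)
             + C_norm m {-1 + \<epsilon><..<1 - \<epsilon>} (\<lambda>x. Um k x + sqrt (2 * P (cs k) x))
             \<le> ennreal (C * \<nu> k)"
proof -
  let ?S = "{-1 + \<epsilon><..<1 - \<epsilon>}"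
  obtain \<kappa> M where \<kappa>: "\<kappa> > 0" "M > 0"
    and adm: "\<And>\<nu> cs Up Um. vanishing_viscosity_seq \<nu> cs c \<Longrightarrow>
        \<forall>k. is_upper_solution (\<nu> k) (cs k) (Up k) \<Longrightarrow>
        \<forall>k. is_lower_solution (\<nu> k) (cs k) (Um k) \<Longrightarrow>
        \<forall>\<^sub>F k in sequentially. admissible \<kappa> M (\<nu> k) (cs k) (Up k) \<and>
          admissible \<kappa> M (\<nu> k) (swap_ends (cs k)) (\<lambda>x. - Um k (- x))"
    by (rule eventually_admissible[OF c nonneg]) (rule that; blast)
  obtain A where A: "A > 0" "\<And>\<nu> c U x. admissible \<kappa> M \<nu> c U \<Longrightarrow> \<nu> < 1 \<Longrightarrow> x \<in> {-1<..<1} \<Longrightarrow>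
       \<bar>(1/2) * (U x)\<^sup>2 - P c x\<bar> \<le> A * \<nu>"
    using upper_quadratic_estimate[OF \<kappa>] by metis
  obtain K0 d where d: "d > 0"
    and K0: "\<And>\<nu> c U j x. admissible \<kappa> M \<nu> c U \<Longrightarrow> \<nu> < d \<Longrightarrow> j \<le> m \<Longrightarrow> x \<in> ?S \<Longrightarrow>
       (deriv ^^ j) (\<lambda>x. (U x - sqrt (2 * P c x)) / \<nu>) differentiable (at x) \<and>
       \<bar>(deriv ^^ j) (\<lambda>x. (U x - sqrt (2 * P c x)) / \<nu>) x\<bar> \<le> K0"
  proof (cases "\<epsilon> < 1")
    case True
    show ?thesis
      by (rule upper_interior_estimate[OF \<kappa> \<epsilon> True, of m]) (use that in blast)
  next
    case False
    \<comment> \<open>The interval is empty.\<close>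
    thus ?thesis using that[of 1 0] by auto
  qed
  define K where "K = max K0 0"
  have K: "(deriv ^^ j) (\<lambda>x. (U x - sqrt (2 * P c x)) / \<nu>) differentiable (at x) \<and>
       \<bar>(deriv ^^ j) (\<lambda>x. (U x - sqrt (2 * P c x)) / \<nu>) x\<bar> \<le> K"
    if "admissible \<kappa> M \<nu> c U" "\<nu> < d" "j \<le> m" "x \<in> ?S" for \<nu> c U j x
    using K0[OF that] by (auto simp: K_def)
  define B where "B = real (Suc m) * K"
  have B: "B \<ge> 0" by (simp add: B_def K_def)
  have C_bound: "C_norm m ?S (\<lambda>x. (s * \<nu>) * ((U (s * x) - sqrt (2 * P c (s * x))) / \<nu>)) \<le> ennreal (B * \<nu>)"
    if a: "admissible \<kappa> M \<nu> c U" "\<nu> < d" and s: "s = 1 \<or> s = -1" for \<nu> c U s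
  proof -
    have "C_norm m ?S (\<lambda>x. (s * \<nu>) * (\<lambda>x. (U x - sqrt (2 * P c x)) / \<nu>) (s * x))
        \<le> ennreal (real (Suc m) * K * \<bar>s * \<nu>\<bar>)"
      by (rule C_norm_affine_le) (use s K[OF a] in \<open>auto simp: K_def\<close>)
    thus ?thesis using s a(1) by (auto simp: B_def admissible_def)
  qed
  show ?thesis
  proof (rule that[of "A + B + 1"])
    show "A + B + 1 > 0" using A(1) B by simp
    fix \<nu> cs Up Um
    assume vv: "vanishing_viscosity_seq \<nu> cs c"
      and up: "\<forall>k. is_upper_solution (\<nu> k) (cs k) (Up k)"
      and lo: "\<forall>k. is_lower_solution (\<nu> k) (cs k) (Um k)"
    have \<nu>: "\<nu> \<longlonglongrightarrow> 0" and \<nu>pos: "\<And>k. \<nu> k > 0" using vv by (auto simp: vanishing_viscosity_seq_def)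
    have small: "\<forall>\<^sub>F k in sequentially. \<nu> k < min 1 d"
      using order_tendstoD(2)[OF \<nu>, of "min 1 d"] d by simp
    show "\<forall>\<^sub>F k in sequentially.
           ennreal (sqrt (\<nu> k)) * Linf_norm {-1<..<1} (\<lambda>x. (1/2) * (Up k x)\<^sup>2 - P (cs k) x)
             + C_norm m ?S (\<lambda>x. Up k x - sqrt (2 * P (cs k) x))
             \<le> ennreal ((A + B + 1) * \<nu> k) \<and>
           ennreal (sqrt (\<nu> k)) * Linf_norm {-1<..<1} (\<lambda>x. (1/2) * (Um k x)\<^sup>2 - P (cs k) x)
             + C_norm m ?S (\<lambda>x. Um k x + sqrt (2 * P (cs k) x))
             \<le> ennreal ((A + B + 1) * \<nu> k)"
      using adm[OF vv up lo] small
    proof eventually_elim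
      case (elim k)
      hence a: "admissible \<kappa> M (\<nu> k) (cs k) (Up k)"
        and b: "admissible \<kappa> M (\<nu> k) (swap_ends (cs k)) (\<lambda>x. - Um k (- x))"
        and s: "\<nu> k < 1" "\<nu> k < d" by auto
      have nz: "\<nu> k \<noteq> 0" using \<nu>pos[of k] by simp
      have cont: "continuous_on {-1<..<1} (Up k)" "continuous_on {-1<..<1} (Um k)"
        using up lo is_solution_continuous_on
        unfolding is_upper_solution_def is_lower_solution_def by blast+
      have "Linf_norm {-1<..<1} (\<lambda>x. (1/2) * (Up k x)\<^sup>2 - P (cs k) x) \<le> ennreal (A * \<nu> k)"
        using A(2)[OF a s(1)] cont by (intro Linf_norm_le continuous_intros) auto
      moreover have "C_norm m ?S (\<lambda>x. Up k x - sqrt (2 * P (cs k) x)) \<le> ennreal (B * \<nu> k)"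
        using C_bound[OF a s(2), of 1] nz by simp
      moreover have "Linf_norm {-1<..<1} (\<lambda>x. (1/2) * (Um k x)\<^sup>2 - P (cs k) x) \<le> ennreal (A * \<nu> k)"
      proof (intro Linf_norm_le continuous_intros cont)
        fix x :: real assume "x \<in> {-1<..<1}"
        hence "- x \<in> {-1<..<1}" by auto
        from A(2)[OF b s(1) this] show "\<bar>(1/2) * (Um k x)\<^sup>2 - P (cs k) x\<bar> \<le> A * \<nu> k"
          by (simp add: P_swap_ends)
      qed
      moreover have "C_norm m ?S (\<lambda>x. Um k x + sqrt (2 * P (cs k) x)) \<le> ennreal (B * \<nu> k)"
        using C_bound[OF b s(2), of "-1"] nz by (simp add: P_swap_ends add.commute)
      ultimately show ?case
        using A(1) B \<nu>pos s by (intro conjI ennreal_rate_le) auto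
    qed
  qed
qed

theorem theorem1p7:
  fixes c :: "real ^ 3"
  assumes "c \<noteq> 0" and "c $ 1 * c $ 2 = 0" and "c $ 3 > c3_star (c $ 1) (c $ 2)"
  shows
    "(\<forall>\<nu> cs Up Um.
        vanishing_viscosity_seq \<nu> cs c \<and>
        (\<forall>k. is_upper_solution (\<nu> k) (cs k) (Up k)) \<and>
        (\<forall>k. is_lower_solution (\<nu> k) (cs k) (Um k)) \<longrightarrow>
        (\<lambda>k. Linf_norm {-1<..<1} (\<lambda>x. Up k x - sqrt (2 * P c x))) \<longlonglongrightarrow> 0 \<and>
        (\<lambda>k. Linf_norm {-1<..<1} (\<lambda>x. Um k x + sqrt (2 * P c x))) \<longlonglongrightarrow> 0)
     \<and>
     (\<forall>\<epsilon>>0. \<forall>m::nat. \<exists>C>0. \<forall>\<nu> cs Up Um.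
        vanishing_viscosity_seq \<nu> cs c \<and>
        (\<forall>k. is_upper_solution (\<nu> k) (cs k) (Up k)) \<and>
        (\<forall>k. is_lower_solution (\<nu> k) (cs k) (Um k)) \<longrightarrow>
        (\<forall>\<^sub>F k in sequentially.
           ennreal (sqrt (\<nu> k)) * Linf_norm {-1<..<1} (\<lambda>x. (1/2) * (Up k x)\<^sup>2 - P (cs k) x)
             + C_norm m {-1 + \<epsilon><..<1 - \<epsilon>} (\<lambda>x. Up k x - sqrt (2 * P (cs k) x))
             \<le> ennreal (C * \<nu> k) \<and>
           ennreal (sqrt (\<nu> k)) * Linf_norm {-1<..<1} (\<lambda>x. (1/2) * (Um k x)\<^sup>2 - P (cs k) x)
             + C_norm m {-1 + \<epsilon><..<1 - \<epsilon>} (\<lambda>x. Um k x + sqrt (2 * P (cs k) x))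
             \<le> ennreal (C * \<nu> k)))"
proof (intro conjI allI impI)
  fix \<nu> cs Up Um
  assume "vanishing_viscosity_seq \<nu> cs c \<and>
    (\<forall>k. is_upper_solution (\<nu> k) (cs k) (Up k)) \<and> (\<forall>k. is_lower_solution (\<nu> k) (cs k) (Um k))"
  thus "(\<lambda>k. Linf_norm {-1<..<1} (\<lambda>x. Up k x - sqrt (2 * P c x))) \<longlonglongrightarrow> 0"
    "(\<lambda>k. Linf_norm {-1<..<1} (\<lambda>x. Um k x + sqrt (2 * P c x))) \<longlonglongrightarrow> 0"
    using solutions_converge_uniformly[OF assms(2,3)] by blast+
next
  fix \<epsilon> :: real and m :: nat assume \<epsilon>: "0 < \<epsilon>"
  show "\<exists>C>0. \<forall>\<nu> cs Up Um.
        vanishing_viscosity_seq \<nu> cs c \<and>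
        (\<forall>k. is_upper_solution (\<nu> k) (cs k) (Up k)) \<and>
        (\<forall>k. is_lower_solution (\<nu> k) (cs k) (Um k)) \<longrightarrow>
        (\<forall>\<^sub>F k in sequentially.
           ennreal (sqrt (\<nu> k)) * Linf_norm {-1<..<1} (\<lambda>x. (1/2) * (Up k x)\<^sup>2 - P (cs k) x)
             + C_norm m {-1 + \<epsilon><..<1 - \<epsilon>} (\<lambda>x. Up k x - sqrt (2 * P (cs k) x))
             \<le> ennreal (C * \<nu> k) \<and>
           ennreal (sqrt (\<nu> k)) * Linf_norm {-1<..<1} (\<lambda>x. (1/2) * (Um k x)\<^sup>2 - P (cs k) x)
             + C_norm m {-1 + \<epsilon><..<1 - \<epsilon>} (\<lambda>x. Um k x + sqrt (2 * P (cs k) x))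
             \<le> ennreal (C * \<nu> k))"
  proof (cases "0 \<le> c $ 1 \<and> 0 \<le> c $ 2")
    case True
    show ?thesis
      by (rule solutions_rate[OF assms(2,3) _ _ \<epsilon>, of m]) (use True in blast)+
  next
    case False
    \<comment> \<open>A sequence as in the hypothesis forces both components of its limit to be nonnegative, so there is none.\<close>
    thus ?thesis using vanishing_viscosity_seq_nonneg by (intro exI[of _ 1]) fastforce
  qed
qed

end
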